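(* Let $p$ be a prime and let $R$ be a Noetherian $\mathbb{F}_p$-algebra which is a Jacobson ring. Then $R$ is semi F-regular if and only if it is weakly F-regular.
   Context: Rings are commutative with $1$. For a Noetherian ring $R$ of characteristic $p$, $R^\circ$ is the complement of the union of the minimal primes of $R$; the tight closure $I^*$ of an ideal $I$ is the set of $z\in R$ for which there are $c\in R^\circ$ and a power $q_0$ of $p$ with $cz^q\in I^{[q]}$ for all powers $q\ge q_0$ of $p$, where $I^{[q]}$ is the ideal generated by $q$-th powers of elements of $I$. $R$ is weakly F-regular if $I^*=I$ for every ideal $I$ of $R$. $R$ is semi F-regular if $R_f$ is weakly F-regular for every $f\in R$; equivalently, for every affine open $U\subseteq\operatorname{Spec}R$, every ideal of $\mathcal{O}_{\operatorname{Spec}R}(U)$ is tightly closed. A Jacobson ring is a ring in which every prime ideal is an intersection of maximal ideals. *)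

theory Defs
  imports "HOL-Algebra.Ring_Divisibility" "HOL-Algebra.IntRing"
begin

text \<open>An \<open>\<bbbF>\<^sub>p\<close>-algebra structure on a ring is a (necessarily unique) ring homomorphism from
  \<open>\<bbbF>\<^sub>p = \<int>/p\<int>\<close>.  The zero ring is allowed.\<close>

definition Fp_algebra :: "nat \<Rightarrow> ('a, 'b) ring_scheme \<Rightarrow> bool" where
  "Fp_algebra p R \<longleftrightarrow> cring R \<and> (\<exists>\<phi>. \<phi> \<in> ring_hom (ZFact (int p)) R)"

text \<open>The intersection with the carrier makes the empty intersection equal to the whole ring.\<close>

definition jacobson_ring :: "('a, 'b) ring_scheme \<Rightarrow> bool" where
  "jacobson_ring R \<longleftrightarrow> cring R \<and>
     (\<forall>P. primeideal P R \<longrightarrow> (\<exists>\<M>. (\<forall>M\<in>\<M>. maximalideal M R) \<and> P = carrier R \<inter> \<Inter>\<M>))"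

definition minimal_prime :: "'a set \<Rightarrow> ('a, 'b) ring_scheme \<Rightarrow> bool" where
  "minimal_prime P R \<longleftrightarrow> primeideal P R \<and> (\<forall>Q. primeideal Q R \<and> Q \<subseteq> P \<longrightarrow> Q = P)"

definition ring_circ :: "('a, 'b) ring_scheme \<Rightarrow> 'a set" where
  "ring_circ R = carrier R - \<Union>{P. minimal_prime P R}"

definition frobenius_power :: "('a, 'b) ring_scheme \<Rightarrow> 'a set \<Rightarrow> nat \<Rightarrow> 'a set" where
  "frobenius_power R I q = Idl\<^bsub>R\<^esub> ((\<lambda>x. x [^]\<^bsub>R\<^esub> q) ` I)"

definition tight_closure :: "nat \<Rightarrow> ('a, 'b) ring_scheme \<Rightarrow> 'a set \<Rightarrow> 'a set" where
  "tight_closure p R I = {z \<in> carrier R. \<exists>c \<in> ring_circ R. \<exists>e\<^sub>0. \<forall>e\<ge>e\<^sub>0.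
     c \<otimes>\<^bsub>R\<^esub> z [^]\<^bsub>R\<^esub> (p ^ e) \<in> frobenius_power R I (p ^ e)}"

text \<open>The next notions are meant for Noetherian rings of characteristic \<open>p\<close>; these hypotheses are
  not part of the definitions (a localization inherits them from the ring).\<close>

definition weakly_F_regular :: "nat \<Rightarrow> ('a, 'b) ring_scheme \<Rightarrow> bool" where
  "weakly_F_regular p R \<longleftrightarrow> (\<forall>I. ideal I R \<longrightarrow> tight_closure p R I = I)"

text \<open>Localization of a commutative ring at a multiplicative set \<open>S\<close>.  The pair \<open>(a, s)\<close>
  represents the fraction \<open>a/s\<close>.\<close>

definition frac_rel :: "('a, 'b) ring_scheme \<Rightarrow> 'a set \<Rightarrow> (('a \<times> 'a) \<times> ('a \<times> 'a)) set" where
  "frac_rel R S = {((a, s), (b, t)). a \<in> carrier R \<and> s \<in> S \<and> b \<in> carrier R \<and> t \<in> S \<and>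
     (\<exists>u\<in>S. u \<otimes>\<^bsub>R\<^esub> (t \<otimes>\<^bsub>R\<^esub> a) = u \<otimes>\<^bsub>R\<^esub> (s \<otimes>\<^bsub>R\<^esub> b))}"

definition localization :: "('a, 'b) ring_scheme \<Rightarrow> 'a set \<Rightarrow> ('a \<times> 'a) set ring" where
  "localization R S = \<lparr>
     carrier = (carrier R \<times> S) // frac_rel R S,
     mult = (\<lambda>A B. \<Union>(a, s)\<in>A. \<Union>(b, t)\<in>B. frac_rel R S `` {(a \<otimes>\<^bsub>R\<^esub> b, s \<otimes>\<^bsub>R\<^esub> t)}),
     one = frac_rel R S `` {(\<one>\<^bsub>R\<^esub>, \<one>\<^bsub>R\<^esub>)},
     zero = frac_rel R S `` {(\<zero>\<^bsub>R\<^esub>, \<one>\<^bsub>R\<^esub>)},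
     add = (\<lambda>A B. \<Union>(a, s)\<in>A. \<Union>(b, t)\<in>B.
       frac_rel R S `` {((t \<otimes>\<^bsub>R\<^esub> a) \<oplus>\<^bsub>R\<^esub> (s \<otimes>\<^bsub>R\<^esub> b), s \<otimes>\<^bsub>R\<^esub> t)})\<rparr>"

definition localization_at_elem :: "('a, 'b) ring_scheme \<Rightarrow> 'a \<Rightarrow> ('a \<times> 'a) set ring" where
  "localization_at_elem R f = localization R (range (\<lambda>n::nat. f [^]\<^bsub>R\<^esub> n))"

definition semi_F_regular :: "nat \<Rightarrow> ('a, 'b) ring_scheme \<Rightarrow> bool" where
  "semi_F_regular p R \<longleftrightarrow> (\<forall>f\<in>carrier R. weakly_F_regular p (localization_at_elem R f))"

end

theory Submission
  imports Defs
begin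

text \<open>
  Weak F-regularity of \<open>R\<^sub>1\<close>, which is a copy of \<open>R\<close>, gives that of \<open>R\<close>.  Only the converse is
  substantial: \<open>R\<close> is weakly F-regular, \<open>J\<close> is an ideal of \<open>R\<^sub>f\<close>, and a fraction \<open>z = x/s\<close> in \<open>J\<^sup>*\<close>
  is supposed to lie outside \<open>J\<close>.

  The key is to replace the contraction of \<open>J\<close> by an ideal modulo which \<open>f\<close> is invertible.  Let \<open>K\<close>
  be maximal among the ideals of \<open>R\<close> that contain the contraction of \<open>J\<close> and no \<open>f\<^sup>n x\<close>.  Then \<open>f\<close>
  is a nonzerodivisor modulo \<open>K\<close>, and the colon ideal \<open>M = (K : x)\<close> is a prime such that \<open>R/M\<close>
  becomes a field when \<open>f\<close> is inverted.  Since \<open>R\<close> is a Jacobson ring and \<open>f\<close> is not in \<open>M\<close>, the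
  ideal \<open>M\<close> is maximal; and by a second use of the maximality of \<open>K\<close> every element of \<open>M\<close> is nilpotent
  modulo \<open>K\<close>.  Hence some \<open>1 - rf\<close> is nilpotent modulo \<open>K\<close>
  (lemma \<open>jacobson_separating_ideal\<close>).  The same then holds modulo every
  Frobenius power \<open>K\<^bsup>[q]\<^esup>\<close>, so factors \<open>f\<close> can be cancelled there
  (lemma \<open>cancel_power_mod_frobenius_power\<close>).

  Let \<open>c = a/t\<close> witness that \<open>z\<close> is in \<open>J\<^sup>*\<close>.  Clearing denominators and cancelling powers of \<open>f\<close>
  gives \<open>a x\<^sup>q \<in> K\<^bsup>[q]\<^esup>\<close> for all large \<open>q\<close>.  The numerator \<open>a\<close> avoids the minimal primes of \<open>R\<close> that
  do not contain \<open>f\<close>, but it may lie in some of the others.  It is corrected by an element \<open>d\<close> killed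
  by a power of \<open>f\<close> such that \<open>a + d\<close> avoids all of the finitely many minimal primes
  (lemma \<open>ring_circ_representative\<close>, by prime avoidance for a coset).  A power of \<open>f\<close> kills \<open>d x\<^sup>q\<close>,
  so \<open>d x\<^sup>q\<close> is in \<open>K\<^bsup>[q]\<^esup>\<close> as well.  Thus \<open>a + d\<close> witnesses \<open>x \<in> K\<^sup>* = K\<close>, which
  contradicts the choice of \<open>K\<close>.
\<close>

section \<open>Ideals of Noetherian rings\<close>

lemma (in noetherian_ring) ex_maximal_ideal_with:
  assumes "ideal I R" "P I"
  shows "\<exists>K. ideal K R \<and> P K \<and> I \<subseteq> K \<and> (\<forall>J. ideal J R \<and> P J \<and> K \<subseteq> J \<longrightarrow> J = K)"
proof -
  define F where "F = {J. ideal J R \<and> P J \<and> I \<subseteq> J}"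
  have "\<exists>K\<in>F. \<forall>J\<in>F. K \<subseteq> J \<longrightarrow> J = K"
  proof (rule subset_Zorn_nonempty)
    show "F \<noteq> {}" using assms by (auto simp: F_def)
    fix C assume C: "C \<noteq> {}" "subset.chain F C"
    then have "subset.chain {I. ideal I R} C"
      by (auto simp: subset_chain_def F_def)
    then have "\<Union>C \<in> C" using ideal_chain_is_trivial C(1) by blast
    then show "\<Union>C \<in> F" using C(2) by (auto simp: subset_chain_def)
  qed
  then obtain K where "K \<in> F" and max: "\<And>J. J \<in> F \<Longrightarrow> K \<subseteq> J \<Longrightarrow> J = K"
    by blast
  then have "ideal K R" "P K" "I \<subseteq> K" by (simp_all add: F_def)
  moreover have "J = K" if "ideal J R" "P J" "K \<subseteq> J" for J
    using max[of J] that \<open>I \<subseteq> K\<close> by (simp add: F_def)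
  ultimately show ?thesis by blast
qed

lemma (in cring) add_cgenideal:
  assumes "ideal I R" "a \<in> carrier R"
  shows "ideal (I <+>\<^bsub>R\<^esub> PIdl a) R" "I \<subseteq> (I <+>\<^bsub>R\<^esub> PIdl a)" "a \<in> I <+>\<^bsub>R\<^esub> PIdl a"
    and "z \<in> I <+>\<^bsub>R\<^esub> PIdl a \<Longrightarrow> \<exists>i\<in>I. \<exists>r\<in>carrier R. z = i \<oplus> r \<otimes> a"
proof -
  interpret I: ideal I R by fact
  show "ideal (I <+>\<^bsub>R\<^esub> PIdl a) R"
    using add_ideals[OF assms(1) cgenideal_ideal[OF assms(2)]] .
  have "\<zero> \<in> PIdl a"
    using additive_subgroup.zero_closed[OF ideal.axioms(1)[OF cgenideal_ideal[OF assms(2)]]] .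
  moreover have "i = i \<oplus> \<zero>" if "i \<in> I" for i using that I.Icarr by simp
  ultimately show "I \<subseteq> (I <+>\<^bsub>R\<^esub> PIdl a)" unfolding set_add_def' by blast
  show "a \<in> I <+>\<^bsub>R\<^esub> PIdl a"
    using cgenideal_self[OF assms(2)] I.zero_closed l_zero[OF assms(2), symmetric]
    unfolding set_add_def' by blast
  show "z \<in> I <+>\<^bsub>R\<^esub> PIdl a \<Longrightarrow> \<exists>i\<in>I. \<exists>r\<in>carrier R. z = i \<oplus> r \<otimes> a"
    by (auto simp: set_add_def' cgenideal_def)
qed

lemma (in cring) ideal_by_closure:
  assumes "I \<subseteq> carrier R" "\<zero> \<in> I"
    and "\<And>x y. x \<in> I \<Longrightarrow> y \<in> I \<Longrightarrow> x \<oplus> y \<in> I"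
    and mult: "\<And>x r. x \<in> I \<Longrightarrow> r \<in> carrier R \<Longrightarrow> r \<otimes> x \<in> I"
  shows "ideal I R"
proof (rule idealI[OF ring_axioms])
  show "subgroup I (add_monoid R)"
  proof (rule add.subgroupI)
    fix x assume x: "x \<in> I"
    then have "\<ominus> x = (\<ominus> \<one>) \<otimes> x" using assms(1) by (auto simp: l_minus)
    with mult[OF x, of "\<ominus> \<one>"] show "\<ominus> x \<in> I" by simp
  qed (use assms in auto)
next
  fix x r assume "x \<in> I" "r \<in> carrier R"
  with mult assms(1) show "r \<otimes> x \<in> I" "x \<otimes> r \<in> I"
    by (auto simp: m_comm[of x r] subset_iff)
qed

text \<open>An ideal that is maximal among those disjoint from \<open>T\<close> is prime: if \<open>a\<close> and \<open>b\<close> lie outside it,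
  then the ideals obtained by adjoining \<open>a\<close> and \<open>b\<close> both meet \<open>T\<close>, and the product of two such
  elements of \<open>T\<close> would lie in the ideal if \<open>a \<otimes> b\<close> did.\<close>

lemma (in noetherian_ring) ex_prime_disjoint_from_mult_set:
  assumes "cring R" and T: "T \<subseteq> carrier R" "\<one> \<in> T" "\<zero> \<notin> T"
    and Tm: "\<And>x y. x \<in> T \<Longrightarrow> y \<in> T \<Longrightarrow> x \<otimes> y \<in> T"
  shows "\<exists>Q. primeideal Q R \<and> Q \<inter> T = {}"
proof -
  interpret cring R by fact
  have "{\<zero>} \<inter> T = {}" using T(3) by simp
  then obtain Q where Q: "ideal Q R" "Q \<inter> T = {}" "{\<zero>} \<subseteq> Q"
    and "\<forall>J. ideal J R \<and> J \<inter> T = {} \<and> Q \<subseteq> J \<longrightarrow> J = Q"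
    using ex_maximal_ideal_with[OF zeroideal, where P = "\<lambda>I. I \<inter> T = {}"] by blast
  then have max: "\<And>J. ideal J R \<Longrightarrow> J \<inter> T = {} \<Longrightarrow> Q \<subseteq> J \<Longrightarrow> J = Q" by blast
  interpret Q: ideal Q R by fact
  have meets: "\<exists>q\<in>Q. \<exists>r\<in>carrier R. q \<oplus> r \<otimes> a \<in> T" if a: "a \<in> carrier R" "a \<notin> Q" for a
  proof -
    have "(Q <+>\<^bsub>R\<^esub> PIdl a) \<inter> T \<noteq> {}"
      using max[of "Q <+>\<^bsub>R\<^esub> PIdl a"] add_cgenideal(1-3)[OF Q(1) a(1)] a(2) by blast
    then show ?thesis using add_cgenideal(4)[OF Q(1) a(1)] by blast
  qed
  have "primeideal Q R"
  proof (rule primeidealI[OF Q(1) is_cring])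
    show "carrier R \<noteq> Q" using Q(2) T by auto
    fix a b assume ab: "a \<in> carrier R" "b \<in> carrier R" "a \<otimes> b \<in> Q"
    show "a \<in> Q \<or> b \<in> Q"
    proof (rule ccontr)
      assume "\<not> ?thesis"
      then obtain q r q' r' where
        h: "q \<in> Q" "r \<in> carrier R" "q \<oplus> r \<otimes> a \<in> T" "q' \<in> Q" "r' \<in> carrier R" "q' \<oplus> r' \<otimes> b \<in> T"
        using meets ab by metis
      have "(q \<oplus> r \<otimes> a) \<otimes> (q' \<oplus> r' \<otimes> b)
          = (q' \<oplus> r' \<otimes> b) \<otimes> q \<oplus> ((r \<otimes> a) \<otimes> q' \<oplus> (r \<otimes> r') \<otimes> (a \<otimes> b))"
        using h(1,2,4,5) ab Q.Icarr by algebra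
      also have "\<dots> \<in> Q"
        by (intro Q.a_closed Q.I_l_closed[OF h(1)] Q.I_l_closed[OF h(4)] Q.I_l_closed[OF ab(3)])
          (use h(2,5) ab Q.Icarr[OF h(4)] in simp_all)
      finally show False using Tm[OF h(3,6)] Q(2) by auto
    qed
  qed
  with Q(2) show ?thesis by blast
qed

text \<open>This is the finiteness of the set of minimal primes over \<open>I\<close>, in a form suited to Noetherian
  induction: an ideal \<open>K\<close> maximal among the counterexamples is neither prime nor the whole ring, so
  \<open>a \<otimes> b \<in> K\<close> for some \<open>a\<close>, \<open>b\<close> outside \<open>K\<close>.  Every prime over \<open>K\<close> contains \<open>a\<close> or \<open>b\<close>, so the
  finite sets that belong to \<open>K + (a)\<close> and \<open>K + (b)\<close> can be united to one for \<open>K\<close>.\<close>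

lemma (in noetherian_ring) finite_primes_below_primes_over_ideal:
  assumes "cring R" "ideal I R"
  shows "\<exists>\<P>. finite \<P> \<and> (\<forall>P\<in>\<P>. primeideal P R) \<and>
    (\<forall>Q. primeideal Q R \<and> I \<subseteq> Q \<longrightarrow> (\<exists>P\<in>\<P>. I \<subseteq> P \<and> P \<subseteq> Q))"
proof (rule ccontr)
  interpret cring R by fact
  define good where "good = (\<lambda>I \<P>. finite \<P> \<and> (\<forall>P\<in>\<P>. primeideal P R) \<and>
    (\<forall>Q. primeideal Q R \<and> I \<subseteq> Q \<longrightarrow> (\<exists>P\<in>\<P>. I \<subseteq> P \<and> P \<subseteq> Q)))"
  assume "\<not> ?thesis"
  then have "\<not> (\<exists>\<P>. good I \<P>)" by (simp add: good_def)
  then obtain K where K: "ideal K R" "\<not> (\<exists>\<P>. good K \<P>)" "I \<subseteq> K"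
    and "\<forall>J. ideal J R \<and> \<not> (\<exists>\<P>. good J \<P>) \<and> K \<subseteq> J \<longrightarrow> J = K"
    using ex_maximal_ideal_with[OF assms(2), where P = "\<lambda>I. \<not> (\<exists>\<P>. good I \<P>)"] by blast
  then have max: "\<And>J. ideal J R \<Longrightarrow> \<not> (\<exists>\<P>. good J \<P>) \<Longrightarrow> K \<subseteq> J \<Longrightarrow> J = K" by blast
  interpret K: ideal K R by fact
  have "\<not> primeideal K R"
    using K(2) by (auto simp: good_def dest!: spec[of _ "{K}"])
  moreover have "carrier R \<noteq> K"
  proof
    assume "carrier R = K"
    then have "\<not> (primeideal Q R \<and> K \<subseteq> Q)" for Q
      using primeideal.I_notcarr primeideal.axioms(1) additive_subgroup.a_subset ideal.axioms(1)
      by blast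
    \<comment> \<open>The unit ideal is served by the empty family, because no prime contains it.\<close>
    then have "good K {}" by (simp add: good_def)
    with K(2) show False by blast
  qed
  ultimately obtain a b where ab: "a \<in> carrier R" "b \<in> carrier R" "a \<otimes> b \<in> K" "a \<notin> K" "b \<notin> K"
    using primeidealI[OF K(1) is_cring] by blast
  have "\<exists>\<P>. good (K <+>\<^bsub>R\<^esub> PIdl x) \<P>" if "x \<in> carrier R" "x \<notin> K" for x
    using max add_cgenideal(1-3)[OF K(1) that(1)] that(2) by blast
  then obtain \<A> \<B> where A: "good (K <+>\<^bsub>R\<^esub> PIdl a) \<A>" and B: "good (K <+>\<^bsub>R\<^esub> PIdl b) \<B>"
    using ab by meson
  have over: "K <+>\<^bsub>R\<^esub> PIdl x \<subseteq> Q" if Qx: "ideal Q R" "K \<subseteq> Q" "x \<in> Q" "x \<in> carrier R" for Q x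
  proof
    interpret Q: ideal Q R by fact
    fix z assume "z \<in> K <+>\<^bsub>R\<^esub> PIdl x"
    then obtain i r where "i \<in> K" "r \<in> carrier R" "z = i \<oplus> r \<otimes> x"
      using add_cgenideal(4)[OF K(1) Qx(4)] by blast
    then show "z \<in> Q" using Qx(2,3) Q.a_closed Q.I_l_closed by blast
  qed
  have "good K (\<A> \<union> \<B>)"
    unfolding good_def
  proof (intro conjI allI impI)
    fix Q assume Q: "primeideal Q R \<and> K \<subseteq> Q"
    interpret Q: primeideal Q R using Q by blast
    have "a \<in> Q \<or> b \<in> Q" using Q.I_prime ab Q by blast
    then show "\<exists>P\<in>\<A> \<union> \<B>. K \<subseteq> P \<and> P \<subseteq> Q"
    proof
      assume "a \<in> Q"
      then have "K <+>\<^bsub>R\<^esub> PIdl a \<subseteq> Q" using over Q.is_ideal Q ab by blast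
      then obtain P where "P \<in> \<A>" "K <+>\<^bsub>R\<^esub> PIdl a \<subseteq> P" "P \<subseteq> Q"
        using A Q unfolding good_def by blast
      then show ?thesis using add_cgenideal(2)[OF K(1) ab(1)] by blast
    next
      assume "b \<in> Q"
      then have "K <+>\<^bsub>R\<^esub> PIdl b \<subseteq> Q" using over Q.is_ideal Q ab by blast
      then obtain P where "P \<in> \<B>" "K <+>\<^bsub>R\<^esub> PIdl b \<subseteq> P" "P \<subseteq> Q"
        using B Q unfolding good_def by blast
      then show ?thesis using add_cgenideal(2)[OF K(1) ab(2)] by blast
    qed
  qed (use A B in \<open>auto simp: good_def\<close>)
  with K(2) show False by blast
qed

lemma (in noetherian_ring) finite_minimal_primes:
  assumes "cring R"
  shows "finite {P. minimal_prime P R}"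
proof -
  interpret cring R by fact
  obtain \<P> where fin: "finite \<P>" and pr: "\<forall>P\<in>\<P>. primeideal P R"
    and below: "\<forall>Q. primeideal Q R \<and> {\<zero>} \<subseteq> Q \<longrightarrow> (\<exists>P\<in>\<P>. {\<zero>} \<subseteq> P \<and> P \<subseteq> Q)"
    using finite_primes_below_primes_over_ideal[OF assms zeroideal] by (elim exE conjE)
  have "Q \<in> \<P>" if Q: "minimal_prime Q R" for Q
  proof -
    interpret Q: primeideal Q R using Q by (simp add: minimal_prime_def)
    obtain P where "P \<in> \<P>" "P \<subseteq> Q"
      using below[rule_format, of Q] Q.primeideal Q.zero_closed by auto
    then show ?thesis using Q pr by (auto simp: minimal_prime_def)
  qed
  then have "{P. minimal_prime P R} \<subseteq> \<P>" by blast
  then show ?thesis using fin finite_subset by blast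
qed

text \<open>Pick an element of each \<open>J\<close> outside the prime ideal; their product lies in every \<open>J\<close>, and it is
  outside the prime ideal by primality.\<close>

lemma (in primeideal) ex_elem_of_ideals_outside:
  assumes "finite \<Q>" "\<And>J. J \<in> \<Q> \<Longrightarrow> ideal J R" "\<And>J. J \<in> \<Q> \<Longrightarrow> \<not> J \<subseteq> I"
  shows "\<exists>e\<in>carrier R. e \<notin> I \<and> (\<forall>J\<in>\<Q>. e \<in> J)"
  using assms
proof (induction \<Q> rule: finite_induct)
  case empty
  then show ?case using I_notcarr a_subset by blast
next
  case (insert J \<Q>)
  then obtain e where e: "e \<in> carrier R" "e \<notin> I" "\<forall>J\<in>\<Q>. e \<in> J" by auto
  obtain j where j: "j \<in> J" "j \<notin> I" using insert.prems by blast
  have jc: "j \<in> carrier R" using ideal.Icarr[OF insert.prems(1) j(1)] by simp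
  have "j \<otimes> e \<notin> I" using I_prime[OF jc e(1)] e(2) j(2) by blast
  moreover have "\<forall>K\<in>insert J \<Q>. j \<otimes> e \<in> K"
    using insert.prems(1) e jc j(1) by (auto intro: ideal.I_l_closed ideal.I_r_closed)
  ultimately show ?case using jc e(1) by blast
qed

text \<open>The primes are treated one at a time.  If the translate \<open>c \<oplus> d\<close> found so far happens to lie
  in the next prime \<open>P\<close>, then \<open>P\<close> does not contain \<open>N\<close>, and by incomparability it contains none of the
  earlier primes; so some \<open>e \<in> N\<close> lies in all earlier primes but not in \<open>P\<close>.  Passing to
  \<open>c \<oplus> d \<oplus> e\<close> changes nothing modulo the earlier primes and moves the element out of \<open>P\<close>.\<close>

lemma (in cring) coset_prime_avoidance:
  assumes N: "ideal N R" and c: "c \<in> carrier R" and "finite \<P>"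
    and "\<And>P. P \<in> \<P> \<Longrightarrow> primeideal P R"
    and "\<And>P Q. P \<in> \<P> \<Longrightarrow> Q \<in> \<P> \<Longrightarrow> P \<subseteq> Q \<Longrightarrow> P = Q"
    and "\<And>P. P \<in> \<P> \<Longrightarrow> c \<in> P \<Longrightarrow> \<not> N \<subseteq> P"
  shows "\<exists>d\<in>N. \<forall>P\<in>\<P>. c \<oplus> d \<notin> P"
  using assms(3-)
proof (induction \<P> rule: finite_induct)
  case empty
  show ?case using additive_subgroup.zero_closed[OF ideal.axioms(1)[OF N]] by blast
next
  interpret N: ideal N R by fact
  case (insert P \<P>)
  then obtain d where d: "d \<in> N" "\<forall>Q\<in>\<P>. c \<oplus> d \<notin> Q" by auto
  interpret P: primeideal P R using insert.prems(1) by blast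
  have dc: "d \<in> carrier R" using d(1) N.Icarr by blast
  have split: "y \<in> Q" if "ideal Q R" "x \<oplus> y \<in> Q" "x \<in> Q" "y \<in> carrier R" for Q x y
  proof -
    interpret Q: ideal Q R by fact
    have "\<ominus> x \<oplus> (x \<oplus> y) \<in> Q" using that Q.a_closed Q.a_inv_closed by blast
    then show ?thesis using that Q.Icarr by (simp add: r_neg1)
  qed
  show ?case
  proof (cases "c \<oplus> d \<in> P")
    case False
    then show ?thesis using d by blast
  next
    case True
    have "\<not> N \<subseteq> P"
    proof
      assume "N \<subseteq> P"
      then have "c \<in> P"
        using split[of P d c] P.is_ideal True d(1) c dc a_comm by auto
      then show False using insert.prems(3) \<open>N \<subseteq> P\<close> by blast
    qed
    moreover have "\<not> Q \<subseteq> P" if "Q \<in> \<P>" for Q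
      using insert.prems(2)[of Q P] insert.hyps(2) that by blast
    ultimately obtain e where e: "e \<in> carrier R" "e \<notin> P" "e \<in> N" "\<forall>Q\<in>\<P>. e \<in> Q"
      using P.ex_elem_of_ideals_outside[of "insert N \<P>"] insert.hyps insert.prems(1) N
      by (metis finite_insert insert_iff primeideal.axioms(1))
    have eqs: "c \<oplus> (d \<oplus> e) = (c \<oplus> d) \<oplus> e" "c \<oplus> (d \<oplus> e) = e \<oplus> (c \<oplus> d)"
      using c dc e(1) by algebra+
    have cd: "c \<oplus> d \<in> carrier R" using c dc by simp
    have "c \<oplus> (d \<oplus> e) \<notin> P"
      using split[OF P.is_ideal _ True e(1)] e(2) eqs(1) by auto
    moreover have "c \<oplus> (d \<oplus> e) \<notin> Q" if "Q \<in> \<P>" for Q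
    proof -
      have "ideal Q R" using insert.prems(1) that primeideal.axioms(1) by blast
      then show ?thesis using split[OF _ _ _ cd, of Q e] e(4) eqs(2) d(2) that by auto
    qed
    moreover have "d \<oplus> e \<in> N" using d(1) e(3) N.a_closed by blast
    ultimately show ?thesis by blast
  qed
qed

text \<open>Localizing at a minimal prime leaves a ring with a single prime, in which \<open>f\<close> is nilpotent.
  Without the localization: if no product \<open>s \<otimes> f [^] n\<close> with \<open>s\<close> outside \<open>P\<close> were zero, then these
  products would form a multiplicative set, and a prime disjoint from it would be contained in \<open>P\<close>
  without containing \<open>f\<close>.\<close>

lemma (in noetherian_ring) minimal_prime_torsion:
  assumes "cring R" "minimal_prime P R" "f \<in> P"
  shows "\<exists>s\<in>carrier R - P. \<exists>n::nat. s \<otimes> f [^] n = \<zero>"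
proof (rule ccontr)
  assume neg: "\<not> ?thesis"
  interpret cring R by fact
  interpret P: primeideal P R using assms(2) by (simp add: minimal_prime_def)
  have f: "f \<in> carrier R" using assms(3) P.Icarr by blast
  define T where "T = {s \<otimes> f [^] n | s n::nat. s \<in> carrier R - P}"
  have one: "\<one> \<in> carrier R - P" using P.one_imp_carrier P.I_notcarr by auto
  have power_in_T: "s \<otimes> f [^] n \<in> T" if "s \<in> carrier R - P" for s and n :: nat
    using that by (auto simp: T_def)
  have "\<exists>Q. primeideal Q R \<and> Q \<inter> T = {}"
  proof (rule ex_prime_disjoint_from_mult_set[OF assms(1)])
    show "T \<subseteq> carrier R" using f by (auto simp: T_def)
    show "\<one> \<in> T" using power_in_T[OF one, of 0] by simp
    show "\<zero> \<notin> T"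
    proof
      assume "\<zero> \<in> T"
      then obtain s n where "s \<in> carrier R - P" "\<zero> = s \<otimes> f [^] (n::nat)"
        unfolding T_def by blast
      then have "\<exists>s\<in>carrier R - P. \<exists>n::nat. s \<otimes> f [^] n = \<zero>"
        by (intro bexI[of _ s] exI[of _ n]) simp_all
      with neg show False ..
    qed
    fix x y assume "x \<in> T" "y \<in> T"
    then obtain s n s' m where xy: "x = s \<otimes> f [^] (n::nat)" "y = s' \<otimes> f [^] (m::nat)"
      and s: "s \<in> carrier R - P" "s' \<in> carrier R - P" by (auto simp: T_def)
    have "x \<otimes> y = (s \<otimes> s') \<otimes> (f [^] n \<otimes> f [^] m)"
      using xy s f by (simp add: m_ac)
    then have "x \<otimes> y = (s \<otimes> s') \<otimes> f [^] (n + m)"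
      using f by (simp add: nat_pow_mult)
    moreover have "s \<otimes> s' \<in> carrier R - P" using s P.I_prime by auto
    ultimately show "x \<otimes> y \<in> T" using power_in_T by simp
  qed
  then obtain Q where Q: "primeideal Q R" "Q \<inter> T = {}" by blast
  interpret Q: primeideal Q R by fact
  have "Q \<subseteq> P"
  proof
    fix y assume y: "y \<in> Q"
    then have yc: "y \<in> carrier R" using Q.Icarr by blast
    show "y \<in> P"
    proof (rule ccontr)
      assume "y \<notin> P"
      then have "y \<otimes> f [^] (0::nat) \<in> T" using yc power_in_T by blast
      then show False using Q(2) y yc by auto
    qed
  qed
  then have "Q = P" using assms(2) Q(1) by (simp add: minimal_prime_def)
  moreover have "f \<in> T" using power_in_T[OF one, of 1] f by simp
  ultimately show False using Q(2) assms(3) by blast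
qed

text \<open>This replaces the usual reduction to ideals primary to a maximal ideal: \<open>K\<close> is an ideal
  containing \<open>I\<close>, still avoiding \<open>x\<close>, modulo which \<open>f\<close> is a unit because \<open>1 - rf\<close> is nilpotent.
  Choosing \<open>K\<close> maximal with respect to avoiding all \<open>f [^] n \<otimes> x\<close> makes the class of \<open>x\<close> generate the
  smallest nonzero ideal of \<open>R/K\<close> after \<open>f\<close> is inverted.\<close>

lemma (in noetherian_ring) jacobson_separating_ideal:
  assumes jac: "jacobson_ring R" and I: "ideal I R" and f: "f \<in> carrier R" and x: "x \<in> carrier R"
    and notin: "\<forall>n::nat. f [^] n \<otimes> x \<notin> I"
  shows "\<exists>K r. \<exists>k::nat. ideal K R \<and> I \<subseteq> K \<and> x \<notin> K \<and> r \<in> carrier R \<and> (\<one> \<ominus> r \<otimes> f) [^] k \<in> K"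
proof -
  interpret cring R using jac by (simp add: jacobson_ring_def)
  obtain K where K: "ideal K R" "\<forall>n::nat. f [^] n \<otimes> x \<notin> K" "I \<subseteq> K"
    and max: "\<forall>J. ideal J R \<and> (\<forall>n::nat. f [^] n \<otimes> x \<notin> J) \<and> K \<subseteq> J \<longrightarrow> J = K"
    using ex_maximal_ideal_with[OF I, where P = "\<lambda>J. \<forall>n::nat. f [^] n \<otimes> x \<notin> J", OF notin]
    by (elim exE conjE)
  interpret K: ideal K R by fact
  have xK: "x \<notin> K" using K(2)[rule_format, of 0] x by simp
  have big: "\<exists>n::nat. \<exists>i\<in>K. \<exists>r\<in>carrier R. f [^] n \<otimes> x = i \<oplus> r \<otimes> a"
    if a: "a \<in> carrier R" "a \<notin> K" for a
  proof -
    have "K <+>\<^bsub>R\<^esub> PIdl a \<noteq> K" using add_cgenideal(3)[OF K(1) a(1)] a(2) by blast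
    then obtain n :: nat where "f [^] n \<otimes> x \<in> K <+>\<^bsub>R\<^esub> PIdl a"
      using max[rule_format, of "K <+>\<^bsub>R\<^esub> PIdl a"] add_cgenideal(1,2)[OF K(1) a(1)] by blast
    then show ?thesis using add_cgenideal(4)[OF K(1) a(1)] by blast
  qed
  \<comment> \<open>If \<open>y\<close> were outside \<open>K\<close>, then \<open>f\<^sup>m x\<close> would be a multiple of \<open>y\<close> modulo \<open>K\<close>, and \<open>f\<^sup>n\<close> would
    push it into \<open>K\<close>.\<close>
  have cancel: "y \<in> K" if y: "y \<in> carrier R" "f [^] n \<otimes> y \<in> K" for y and n :: nat
  proof (rule ccontr)
    assume "y \<notin> K"
    then obtain m i r where h: "i \<in> K" "r \<in> carrier R" "f [^] (m::nat) \<otimes> x = i \<oplus> r \<otimes> y"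
      using big y(1) by blast
    have "f [^] (n + m) \<otimes> x = f [^] n \<otimes> (f [^] m \<otimes> x)"
      using f x by (simp add: nat_pow_mult[symmetric] m_assoc)
    also have "\<dots> = f [^] n \<otimes> i \<oplus> r \<otimes> (f [^] n \<otimes> y)"
      using h f y(1) K.Icarr[OF h(1)] by (simp add: r_distr m_ac)
    also have "\<dots> \<in> K"
      using K.a_closed[OF K.I_l_closed[OF h(1)] K.I_l_closed[OF y(2) h(2)]] f by simp
    finally show False using K(2) by blast
  qed
  define M where "M = {y \<in> carrier R. x \<otimes> y \<in> K}"
  have M: "ideal M R" unfolding M_def by (rule K.helper_max_prime[OF is_cring x])
  interpret M: ideal M R by (rule M)
  have M_I: "y \<in> M" if "y \<in> carrier R" "x \<otimes> y \<in> K" for y using that unfolding M_def by blast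
  have M_D: "x \<otimes> y \<in> K" if "y \<in> M" for y using that unfolding M_def by blast
  \<comment> \<open>Modulo \<open>M\<close>, every nonzero element divides a power of \<open>f\<close>.\<close>
  have unit: "\<exists>n::nat. \<exists>r\<in>carrier R. f [^] n \<ominus> r \<otimes> y \<in> M" if y: "y \<in> carrier R" "y \<notin> M" for y
  proof -
    have xy: "x \<otimes> y \<in> carrier R" using y(1) x by blast
    have xyK: "x \<otimes> y \<notin> K" using y unfolding M_def by blast
    from big[OF xy xyK]
    obtain n i r where h: "i \<in> K" "r \<in> carrier R" "f [^] (n::nat) \<otimes> x = i \<oplus> r \<otimes> (x \<otimes> y)"
      by (elim exE bexE)
    define g where "g = f [^] n"
    have g: "g \<in> carrier R" "g \<otimes> x = i \<oplus> r \<otimes> (x \<otimes> y)" using f h(3) by (simp_all add: g_def)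
    have "x \<otimes> (g \<ominus> r \<otimes> y) = g \<otimes> x \<ominus> r \<otimes> (x \<otimes> y)"
      using g(1) h(2) x y(1) by algebra
    also have "\<dots> = i"
      unfolding g(2) using g(1) h(2) x y(1) K.Icarr[OF h(1)] by algebra
    finally have "x \<otimes> (g \<ominus> r \<otimes> y) \<in> K" using h(1) by simp
    then have "g \<ominus> r \<otimes> y \<in> M" using M_I[OF minus_closed[OF g(1) m_closed[OF h(2) y(1)]]] by blast
    then show ?thesis using h(2) g_def by blast
  qed
  have Mcancel: "y \<in> M" if y: "y \<in> carrier R" "f [^] n \<otimes> y \<in> M" for y and n :: nat
  proof -
    have "x \<otimes> (f [^] n \<otimes> y) = f [^] n \<otimes> (x \<otimes> y)" using x y(1) f by (simp add: m_ac)
    then have "x \<otimes> y \<in> K" using cancel[of "x \<otimes> y" n] M_D[OF y(2)] y(1) x by simp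
    then show ?thesis using M_I y(1) by blast
  qed
  have "primeideal M R"
  proof (rule primeidealI[OF M is_cring])
    show "carrier R \<noteq> M" using xK M_D[of \<one>] x by auto
    fix a b assume ab: "a \<in> carrier R" "b \<in> carrier R" "a \<otimes> b \<in> M"
    show "a \<in> M \<or> b \<in> M"
    proof (cases "a \<in> M")
      case False
      then obtain n r where h: "r \<in> carrier R" "f [^] (n::nat) \<ominus> r \<otimes> a \<in> M" using unit ab(1) by blast
      define g where "g = f [^] n"
      have g: "g \<in> carrier R" "g \<ominus> r \<otimes> a \<in> M" using f h(2) by (simp_all add: g_def)
      have "g \<otimes> b = b \<otimes> (g \<ominus> r \<otimes> a) \<oplus> r \<otimes> (a \<otimes> b)"
        using g(1) h(1) ab by algebra
      also have "\<dots> \<in> M"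
        using M.a_closed[OF M.I_l_closed[OF g(2) ab(2)] M.I_l_closed[OF ab(3) h(1)]] .
      finally show ?thesis using Mcancel[of b n] ab(2) by (simp add: g_def)
    qed simp
  qed
  \<comment> \<open>The Jacobson property provides a maximal ideal \<open>m\<close> over \<open>M\<close> without \<open>f\<close>.  It equals \<open>M\<close>,
    because an element of \<open>m\<close> outside \<open>M\<close> would divide a power of \<open>f\<close> modulo \<open>M\<close>.\<close>
  then obtain \<M> where \<M>: "\<forall>m\<in>\<M>. maximalideal m R" "M = carrier R \<inter> \<Inter>\<M>"
    using jac unfolding jacobson_ring_def by blast
  have "f \<notin> M"
  proof
    assume "f \<in> M"
    then have "f [^] (1::nat) \<otimes> x \<in> K" using M_D[of f] x f by (simp add: m_comm)
    then show False using K(2) by blast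
  qed
  then obtain m where m: "m \<in> \<M>" "f \<notin> m" using \<M>(2) f by blast
  have Mm: "M \<subseteq> m" using m(1) \<M>(2) by blast
  interpret m: maximalideal m R using m(1) \<M>(1) by blast
  interpret m: primeideal m R using maximalideal_prime[OF m.is_maximalideal] .
  have fpow: "f [^] n \<notin> m" for n :: nat
  proof (induction n)
    case 0
    show ?case using m.one_imp_carrier m.I_notcarr by auto
  next
    case (Suc n)
    show ?case using m.I_prime[of "f [^] n" f] f m(2) Suc by auto
  qed
  have "m \<subseteq> M"
  proof
    fix y assume y: "y \<in> m"
    then have yc: "y \<in> carrier R" using m.Icarr by blast
    show "y \<in> M"
    proof (rule ccontr)
      assume "y \<notin> M"
      then obtain n r where h: "r \<in> carrier R" "f [^] (n::nat) \<ominus> r \<otimes> y \<in> M" using unit yc by blast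
      define g where "g = f [^] n"
      have g: "g \<in> carrier R" "g \<ominus> r \<otimes> y \<in> m" using f h(2) Mm by (auto simp: g_def)
      have "g = (g \<ominus> r \<otimes> y) \<oplus> r \<otimes> y" using g(1) h(1) yc by algebra
      moreover have "\<dots> \<in> m" using m.a_closed[OF g(2) m.I_l_closed[OF y h(1)]] .
      ultimately show False using fpow g_def by simp
    qed
  qed
  then have maxM: "maximalideal M R" using Mm m.is_maximalideal by (simp add: subset_antisym)
  have "M <+>\<^bsub>R\<^esub> PIdl f = carrier R"
    using maximalideal.I_maximal[OF maxM add_cgenideal(1)[OF M f] add_cgenideal(2)[OF M f]]
      additive_subgroup.a_subset[OF ideal.axioms(1)[OF add_cgenideal(1)[OF M f]]]
      add_cgenideal(3)[OF M f] \<open>f \<notin> M\<close> by blast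
  then obtain w r where w: "w \<in> M" "r \<in> carrier R" "\<one> = w \<oplus> r \<otimes> f"
    using add_cgenideal(4)[OF M f, of \<one>] by auto
  have wc: "w \<in> carrier R" using w(1) M.Icarr by blast
  have weq: "\<one> \<ominus> r \<otimes> f = w" unfolding w(3) using wc w(2) f by algebra
  \<comment> \<open>Nilpotency of \<open>w\<close> modulo \<open>K\<close>: the chain of colon ideals \<open>(K : w\<^sup>n)\<close> becomes stationary.  If
    \<open>w\<^sup>n\<close> were outside \<open>K\<close> at that point, then \<open>f\<^sup>l x = i + s w\<^sup>n\<close> with \<open>i\<close> in \<open>K\<close>; multiplication by \<open>w\<close>
    gives \<open>s w\<^bsup>n+1\<^esup> \<in> K\<close>, hence \<open>s w\<^sup>n \<in> K\<close>, and so \<open>f\<^sup>l x \<in> K\<close>.\<close>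
  define A where "A n = {y \<in> carrier R. w [^] n \<otimes> y \<in> K}" for n :: nat
  have A: "ideal (A n) R" for n
    unfolding A_def by (rule K.helper_max_prime[OF is_cring]) (use wc in simp)
  obtain n where Amax: "\<forall>J. ideal J R \<and> (\<exists>k. J = A k) \<and> A n \<subseteq> J \<longrightarrow> J = A n"
    using ex_maximal_ideal_with[OF A[of 0], where P = "\<lambda>J. \<exists>k. J = A k"] by blast
  have ASuc: "A (Suc n) = A n"
  proof -
    have "A n \<subseteq> A (Suc n)"
    proof
      fix y assume y: "y \<in> A n"
      then have "w \<otimes> (w [^] n \<otimes> y) \<in> K" using wc K.I_l_closed by (auto simp: A_def)
      moreover have "y \<in> carrier R" using y by (simp add: A_def)
      ultimately show "y \<in> A (Suc n)" using wc by (simp add: A_def m_ac)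
    qed
    then show ?thesis using Amax A by blast
  qed
  have "w [^] n \<in> K"
  proof (rule ccontr)
    assume "w [^] n \<notin> K"
    from big[OF nat_pow_closed[OF wc] this]
    obtain l i s where h: "i \<in> K" "s \<in> carrier R" "f [^] (l::nat) \<otimes> x = i \<oplus> s \<otimes> w [^] n"
      by (elim exE bexE)
    define g v where "g = f [^] l" and "v = w [^] n"
    have gv: "g \<in> carrier R" "v \<in> carrier R" "g \<otimes> x = i \<oplus> s \<otimes> v"
      using h(3) f wc by (simp_all add: g_def v_def)
    note ic = K.Icarr[OF h(1)]
    have xw: "x \<otimes> w \<in> K" using M_D w(1) by blast
    have "(v \<otimes> w) \<otimes> s = w \<otimes> ((i \<oplus> s \<otimes> v) \<ominus> i)"
      using gv(1,2) wc h(2) ic by algebra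
    also have "\<dots> = g \<otimes> (x \<otimes> w) \<ominus> w \<otimes> i"
      unfolding gv(3)[symmetric] using gv(1,2) wc h(2) ic x by algebra
    also have "\<dots> \<in> K"
      unfolding a_minus_def using K.a_closed[OF K.I_l_closed[OF xw gv(1)] K.a_inv_closed[OF K.I_l_closed[OF h(1) wc]]] .
    finally have "s \<in> A (Suc n)" using h(2) by (simp add: A_def v_def)
    then have "v \<otimes> s \<in> K" unfolding ASuc by (simp add: A_def v_def)
    then have "s \<otimes> v \<in> K" using m_comm[OF gv(2) h(2)] by simp
    then have "g \<otimes> x \<in> K" unfolding gv(3) using K.a_closed h(1) by blast
    then show False using K(2) g_def by blast
  qed
  then show ?thesis using K(1,3) xK w(2) weq by blast
qed

text \<open>If \<open>f y\<close> is in \<open>K\<close>, then \<open>y\<close> is congruent to \<open>(1 - rf) y\<close> modulo \<open>K\<close>, and hence to \<open>(1 - rf)\<^sup>j y\<close>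
  for every \<open>j\<close>.\<close>

lemma (in cring) cancel_power_mod_ideal:
  assumes K: "ideal K R" and car: "f \<in> carrier R" "r \<in> carrier R" "y \<in> carrier R"
    and nil: "(\<one> \<ominus> r \<otimes> f) [^] (j::nat) \<in> K" and fy: "f [^] (n::nat) \<otimes> y \<in> K"
  shows "y \<in> K"
proof -
  interpret K: ideal K R by fact
  define w where "w = \<one> \<ominus> r \<otimes> f"
  have w: "w \<in> carrier R" using car by (simp add: w_def)
  have step: "y \<in> K" if y: "y \<in> carrier R" "f \<otimes> y \<in> K" for y
  proof -
    have "w [^] i \<otimes> y \<in> K \<Longrightarrow> y \<in> K" for i :: nat
    proof (induction i)
      case 0
      then show ?case using y by simp
    next
      case (Suc i)
      define v where "v = w [^] i"
      have v: "v \<in> carrier R" using w by (simp add: v_def)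
      have vwy: "(v \<otimes> w) \<otimes> y \<in> K" using Suc.prems by (simp add: v_def)
      have "v \<otimes> y = (v \<otimes> w) \<otimes> y \<oplus> (v \<otimes> r) \<otimes> (f \<otimes> y)"
        unfolding w_def using v car(1,2) y(1) by algebra
      also have "\<dots> \<in> K"
        using K.a_closed[OF vwy K.I_l_closed[OF y(2), of "v \<otimes> r"]] v car by simp
      finally show ?case using Suc.IH by (simp add: v_def)
    qed
    moreover have "w [^] j \<otimes> y \<in> K" using K.I_r_closed[OF nil y(1)] by (simp add: w_def)
    ultimately show ?thesis by blast
  qed
  from fy show ?thesis
  proof (induction n)
    case 0
    then show ?case using car by simp
  next
    case (Suc n)
    have "f \<otimes> (f [^] n \<otimes> y) \<in> K" using Suc.prems car by (simp add: m_ac)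
    then show ?case using Suc.IH step[of "f [^] n \<otimes> y"] car by simp
  qed
qed

section \<open>Frobenius powers and tight closure\<close>

lemma (in cring) ideal_frobenius_power:
  assumes "ideal I R"
  shows "ideal (frobenius_power R I q) R"
    and "x \<in> I \<Longrightarrow> x [^] q \<in> frobenius_power R I q"
proof -
  have sub: "(\<lambda>x. x [^] q) ` I \<subseteq> carrier R" using ideal.Icarr[OF assms] by auto
  show "ideal (frobenius_power R I q) R"
    unfolding frobenius_power_def using genideal_ideal[OF sub] .
  show "x \<in> I \<Longrightarrow> x [^] q \<in> frobenius_power R I q"
    unfolding frobenius_power_def using genideal_self[OF sub] by blast
qed

lemma (in cring) frobenius_power_subset:
  assumes "ideal K R" "\<And>x. x \<in> I \<Longrightarrow> x [^] q \<in> K"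
  shows "frobenius_power R I q \<subseteq> K"
  unfolding frobenius_power_def using assms by (intro genideal_minimal) auto

lemma (in cring) ideal_subset_tight_closure:
  assumes I: "ideal I R"
  shows "I \<subseteq> tight_closure p R I"
proof
  fix z assume z: "z \<in> I"
  then have zc: "z \<in> carrier R" using ideal.Icarr[OF I] by blast
  have "\<one> \<notin> P" if "minimal_prime P R" for P
  proof -
    interpret P: primeideal P R using that by (simp add: minimal_prime_def)
    show ?thesis using P.one_imp_carrier P.I_notcarr by blast
  qed
  then have "\<one> \<in> ring_circ R" by (auto simp: ring_circ_def)
  moreover have "\<one> \<otimes> z [^] (p ^ e) \<in> frobenius_power R I (p ^ e)" for e
    using ideal_frobenius_power(2)[OF I z] zc by simp
  ultimately show "z \<in> tight_closure p R I" using zc unfolding tight_closure_def by blast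
qed

text \<open>The nilpotency of \<open>1 - rf\<close> modulo \<open>I\<close> passes to the Frobenius power, with exponent \<open>k * q\<close>
  instead of \<open>k\<close>.  This is why a single choice of \<open>I\<close> serves all \<open>q\<close> at once.\<close>

lemma (in cring) cancel_power_mod_frobenius_power:
  assumes I: "ideal I R" and car: "f \<in> carrier R" "r \<in> carrier R" "y \<in> carrier R"
    and nil: "(\<one> \<ominus> r \<otimes> f) [^] (k::nat) \<in> I"
    and fy: "f [^] (n::nat) \<otimes> y \<in> frobenius_power R I q"
  shows "y \<in> frobenius_power R I q"
proof (rule cancel_power_mod_ideal[OF ideal_frobenius_power(1)[OF I] car _ fy])
  show "(\<one> \<ominus> r \<otimes> f) [^] (k * q) \<in> frobenius_power R I q"
    using ideal_frobenius_power(2)[OF I nil, of q] car by (simp add: nat_pow_pow)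
qed

section \<open>Localization\<close>

locale mult_subset = cring R for R (structure) +
  fixes S :: "'a set"
  assumes S_subset: "S \<subseteq> carrier R"
    and one_in_S: "\<one> \<in> S"
    and S_mult: "s \<in> S \<Longrightarrow> t \<in> S \<Longrightarrow> s \<otimes> t \<in> S"
begin

definition frac :: "'a \<Rightarrow> 'a \<Rightarrow> ('a \<times> 'a) set" where
  "frac a s = frac_rel R S `` {(a, s)}"

abbreviation L :: "('a \<times> 'a) set ring" where
  "L \<equiv> localization R S"

lemma S_carrier: "s \<in> S \<Longrightarrow> s \<in> carrier R"
  using S_subset by blast

lemma frac_rel_iff:
  "((a, s), (b, t)) \<in> frac_rel R S \<longleftrightarrow> a \<in> carrier R \<and> s \<in> S \<and> b \<in> carrier R \<and> t \<in> S \<and>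
     (\<exists>u\<in>S. u \<otimes> (t \<otimes> a) = u \<otimes> (s \<otimes> b))"
  by (simp add: frac_rel_def)

lemma equiv_frac_rel: "equiv (carrier R \<times> S) (frac_rel R S)"
proof (rule equivI)
  show "frac_rel R S \<subseteq> (carrier R \<times> S) \<times> (carrier R \<times> S)"
    by (auto simp: frac_rel_def)
  show "refl_on (carrier R \<times> S) (frac_rel R S)"
    using one_in_S by (auto simp: refl_on_def frac_rel_def)
  show "sym (frac_rel R S)"
  proof (rule symI)
    fix x y assume "(x, y) \<in> frac_rel R S"
    then show "(y, x) \<in> frac_rel R S"
      by (cases x, cases y) (auto simp: frac_rel_iff intro: sym)
  qed
  show "trans (frac_rel R S)"
  proof (rule transI)
    fix x y z assume xy: "(x, y) \<in> frac_rel R S" "(y, z) \<in> frac_rel R S"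
    obtain a s b t c w where eqs: "x = (a, s)" "y = (b, t)" "z = (c, w)"
      by (metis surj_pair)
    from xy obtain u v where uv: "u \<in> S" "u \<otimes> (t \<otimes> a) = u \<otimes> (s \<otimes> b)"
        "v \<in> S" "v \<otimes> (w \<otimes> b) = v \<otimes> (t \<otimes> c)"
      and car: "a \<in> carrier R" "s \<in> S" "b \<in> carrier R" "t \<in> S" "c \<in> carrier R" "w \<in> S"
      unfolding eqs frac_rel_iff by blast
    note car' = car(1,3,5) car(2,4,6)[THEN S_carrier] uv(1,3)[THEN S_carrier]
    have "(u \<otimes> v \<otimes> t) \<otimes> (w \<otimes> a) = (v \<otimes> w) \<otimes> (u \<otimes> (t \<otimes> a))"
      using car' by (simp add: m_ac)
    also have "\<dots> = (u \<otimes> s) \<otimes> (v \<otimes> (w \<otimes> b))"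
      unfolding uv(2) using car' by (simp add: m_ac)
    also have "\<dots> = (u \<otimes> v \<otimes> t) \<otimes> (s \<otimes> c)"
      unfolding uv(4) using car' by (simp add: m_ac)
    finally have "(u \<otimes> v \<otimes> t) \<otimes> (w \<otimes> a) = (u \<otimes> v \<otimes> t) \<otimes> (s \<otimes> c)" .
    moreover have "u \<otimes> v \<otimes> t \<in> S" using uv(1,3) car(4) S_mult by blast
    ultimately show "(x, z) \<in> frac_rel R S"
      unfolding eqs frac_rel_iff using car by blast
  qed
qed

lemma frac_eq_iff:
  assumes "a \<in> carrier R" "s \<in> S" "b \<in> carrier R" "t \<in> S"
  shows "frac a s = frac b t \<longleftrightarrow> (\<exists>u\<in>S. u \<otimes> (t \<otimes> a) = u \<otimes> (s \<otimes> b))"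
  unfolding frac_def
  using eq_equiv_class_iff[OF equiv_frac_rel, of "(a, s)" "(b, t)"] assms
  by (simp add: frac_rel_iff)

lemma frac_eqI:
  assumes "a \<in> carrier R" "s \<in> S" "b \<in> carrier R" "t \<in> S" "t \<otimes> a = s \<otimes> b"
  shows "frac a s = frac b t"
  using frac_eq_iff[OF assms(1-4)] assms(5) one_in_S by auto

lemma frac_cancel:
  assumes "a \<in> carrier R" "s \<in> S" "u \<in> S"
  shows "frac (u \<otimes> a) (u \<otimes> s) = frac a s"
  using assms S_mult S_carrier[OF assms(2)] S_carrier[OF assms(3)]
  by (intro frac_eqI) (auto simp: m_ac)

lemma in_frac_iff:
  assumes "a \<in> carrier R" "s \<in> S"
  shows "(b, t) \<in> frac a s \<longleftrightarrow> b \<in> carrier R \<and> t \<in> S \<and> frac b t = frac a s"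
proof -
  have "(b, t) \<in> frac a s \<longleftrightarrow> b \<in> carrier R \<and> t \<in> S \<and> (\<exists>u\<in>S. u \<otimes> (t \<otimes> a) = u \<otimes> (s \<otimes> b))"
    using assms by (simp add: frac_def frac_rel_iff)
  also have "\<dots> \<longleftrightarrow> b \<in> carrier R \<and> t \<in> S \<and> frac b t = frac a s"
    using frac_eq_iff[OF assms, of b t] by auto
  finally show ?thesis .
qed

lemma carrier_L: "carrier L = {frac a s | a s. a \<in> carrier R \<and> s \<in> S}"
  by (auto simp: localization_def quotient_def frac_def)

lemma frac_closed: "a \<in> carrier R \<Longrightarrow> s \<in> S \<Longrightarrow> frac a s \<in> carrier L"
  unfolding carrier_L by blast

lemma frac_cases:
  assumes "x \<in> carrier L"
  obtains a s where "a \<in> carrier R" "s \<in> S" "x = frac a s"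
  using assms unfolding carrier_L by blast

lemma one_L: "\<one>\<^bsub>L\<^esub> = frac \<one> \<one>" and zero_L: "\<zero>\<^bsub>L\<^esub> = frac \<zero> \<one>"
  by (simp_all add: localization_def frac_def)

text \<open>The ring operations of the localization are unions over all representatives; such a union
  collapses to its value at any chosen representatives once this value is independent of them.\<close>

lemma UN_frac_const:
  assumes "a \<in> carrier R" "s \<in> S" "b \<in> carrier R" "t \<in> S"
    and "\<And>a' s' b' t'. a' \<in> carrier R \<Longrightarrow> s' \<in> S \<Longrightarrow> b' \<in> carrier R \<Longrightarrow> t' \<in> S \<Longrightarrow>
      frac a' s' = frac a s \<Longrightarrow> frac b' t' = frac b t \<Longrightarrow> F a' s' b' t' = F a s b t"
  shows "(\<Union>(a', s')\<in>frac a s. \<Union>(b', t')\<in>frac b t. F a' s' b' t') = F a s b t"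
proof
  have mem: "(a, s) \<in> frac a s" "(b, t) \<in> frac b t"
    using assms(1-4) by (simp_all add: in_frac_iff)
  then show "F a s b t \<subseteq> (\<Union>(a', s')\<in>frac a s. \<Union>(b', t')\<in>frac b t. F a' s' b' t')"
    by blast
  show "(\<Union>(a', s')\<in>frac a s. \<Union>(b', t')\<in>frac b t. F a' s' b' t') \<subseteq> F a s b t"
  proof
    fix z assume "z \<in> (\<Union>(a', s')\<in>frac a s. \<Union>(b', t')\<in>frac b t. F a' s' b' t')"
    then obtain a' s' b' t' where z: "(a', s') \<in> frac a s" "(b', t') \<in> frac b t" "z \<in> F a' s' b' t'"
      by blast
    then show "z \<in> F a s b t"
      using assms(5)[of a' s' b' t'] by (simp add: in_frac_iff assms(1-4))
  qed
qed

lemma frac_mult: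
  assumes car: "a \<in> carrier R" "s \<in> S" "b \<in> carrier R" "t \<in> S"
  shows "frac a s \<otimes>\<^bsub>L\<^esub> frac b t = frac (a \<otimes> b) (s \<otimes> t)"
proof -
  have "frac a s \<otimes>\<^bsub>L\<^esub> frac b t =
      (\<Union>(a', s')\<in>frac a s. \<Union>(b', t')\<in>frac b t. frac (a' \<otimes> b') (s' \<otimes> t'))"
    by (simp add: localization_def frac_def)
  also have "\<dots> = frac (a \<otimes> b) (s \<otimes> t)"
  proof (rule UN_frac_const[OF car])
    fix a' s' b' t'
    assume car': "a' \<in> carrier R" "s' \<in> S" "b' \<in> carrier R" "t' \<in> S"
      and "frac a' s' = frac a s" "frac b' t' = frac b t"
    then obtain u v where uv: "u \<in> S" "u \<otimes> (s \<otimes> a') = u \<otimes> (s' \<otimes> a)"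
        "v \<in> S" "v \<otimes> (t \<otimes> b') = v \<otimes> (t' \<otimes> b)"
      using frac_eq_iff car by metis
    note all = car(1,3) car'(1,3) car(2,4)[THEN S_carrier] car'(2,4)[THEN S_carrier]
      uv(1,3)[THEN S_carrier]
    have "(u \<otimes> v) \<otimes> ((s \<otimes> t) \<otimes> (a' \<otimes> b')) = (u \<otimes> (s \<otimes> a')) \<otimes> (v \<otimes> (t \<otimes> b'))"
      using all by (simp add: m_ac)
    also have "\<dots> = (u \<otimes> v) \<otimes> ((s' \<otimes> t') \<otimes> (a \<otimes> b))"
      unfolding uv(2,4) using all by (simp add: m_ac)
    finally show "frac (a' \<otimes> b') (s' \<otimes> t') = frac (a \<otimes> b) (s \<otimes> t)"
      using frac_eq_iff car car' S_mult m_closed uv(1,3) by metis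
  qed
  finally show ?thesis .
qed

lemma frac_add:
  assumes car: "a \<in> carrier R" "s \<in> S" "b \<in> carrier R" "t \<in> S"
  shows "frac a s \<oplus>\<^bsub>L\<^esub> frac b t = frac (t \<otimes> a \<oplus> s \<otimes> b) (s \<otimes> t)"
proof -
  have "frac a s \<oplus>\<^bsub>L\<^esub> frac b t =
      (\<Union>(a', s')\<in>frac a s. \<Union>(b', t')\<in>frac b t. frac (t' \<otimes> a' \<oplus> s' \<otimes> b') (s' \<otimes> t'))"
    by (simp add: localization_def frac_def)
  also have "\<dots> = frac (t \<otimes> a \<oplus> s \<otimes> b) (s \<otimes> t)"
  proof (rule UN_frac_const[OF car])
    fix a' s' b' t'
    assume car': "a' \<in> carrier R" "s' \<in> S" "b' \<in> carrier R" "t' \<in> S"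
      and "frac a' s' = frac a s" "frac b' t' = frac b t"
    then obtain u v where uv: "u \<in> S" "u \<otimes> (s \<otimes> a') = u \<otimes> (s' \<otimes> a)"
        "v \<in> S" "v \<otimes> (t \<otimes> b') = v \<otimes> (t' \<otimes> b)"
      using frac_eq_iff car by metis
    note all = car(1,3) car'(1,3) car(2,4)[THEN S_carrier] car'(2,4)[THEN S_carrier]
      uv(1,3)[THEN S_carrier]
    have "(u \<otimes> v) \<otimes> ((s \<otimes> t) \<otimes> (t' \<otimes> a' \<oplus> s' \<otimes> b'))
        = (v \<otimes> t \<otimes> t') \<otimes> (u \<otimes> (s \<otimes> a')) \<oplus> (u \<otimes> s \<otimes> s') \<otimes> (v \<otimes> (t \<otimes> b'))"
      using all by algebra
    also have "\<dots> = (u \<otimes> v) \<otimes> ((s' \<otimes> t') \<otimes> (t \<otimes> a \<oplus> s \<otimes> b))"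
      unfolding uv(2,4) using all by algebra
    finally have eq: "(u \<otimes> v) \<otimes> ((s \<otimes> t) \<otimes> (t' \<otimes> a' \<oplus> s' \<otimes> b'))
        = (u \<otimes> v) \<otimes> ((s' \<otimes> t') \<otimes> (t \<otimes> a \<oplus> s \<otimes> b))" .
    have "t' \<otimes> a' \<oplus> s' \<otimes> b' \<in> carrier R" "t \<otimes> a \<oplus> s \<otimes> b \<in> carrier R"
      using all by simp_all
    then show "frac (t' \<otimes> a' \<oplus> s' \<otimes> b') (s' \<otimes> t') = frac (t \<otimes> a \<oplus> s \<otimes> b) (s \<otimes> t)"
      using frac_eq_iff[of _ "s' \<otimes> t'" _ "s \<otimes> t"] S_mult[OF car(2,4)] S_mult[OF car'(2,4)]
        S_mult[OF uv(1,3)] eq by blast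
  qed
  finally show ?thesis .
qed

lemma cring_L: "cring L"
proof (rule cringI)
  show "abelian_group L"
  proof (rule abelian_groupI)
    show "\<zero>\<^bsub>L\<^esub> \<in> carrier L" unfolding zero_L using frac_closed one_in_S by blast
  next
    fix x y assume "x \<in> carrier L" "y \<in> carrier L"
    then obtain a s b t where h: "a \<in> carrier R" "s \<in> S" "x = frac a s" "b \<in> carrier R" "t \<in> S" "y = frac b t"
      by (metis frac_cases)
    note all = h(1,4) h(2,5)[THEN S_carrier]
    show "x \<oplus>\<^bsub>L\<^esub> y \<in> carrier L"
      unfolding h frac_add[OF h(1,2,4,5)] using all S_mult[OF h(2,5)] by (intro frac_closed) auto
    show "x \<oplus>\<^bsub>L\<^esub> y = y \<oplus>\<^bsub>L\<^esub> x"
      unfolding h frac_add[OF h(1,2,4,5)] frac_add[OF h(4,5,1,2)]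
      using all by (simp add: a_comm m_comm)
  next
    fix x y z assume "x \<in> carrier L" "y \<in> carrier L" "z \<in> carrier L"
    then obtain a s b t c w where h: "a \<in> carrier R" "s \<in> S" "x = frac a s"
      "b \<in> carrier R" "t \<in> S" "y = frac b t" "c \<in> carrier R" "w \<in> S" "z = frac c w"
      by (metis frac_cases)
    note all = h(1,4,7) h(2,5,8)[THEN S_carrier]
    have "(x \<oplus>\<^bsub>L\<^esub> y) \<oplus>\<^bsub>L\<^esub> z = frac (w \<otimes> (t \<otimes> a \<oplus> s \<otimes> b) \<oplus> (s \<otimes> t) \<otimes> c) ((s \<otimes> t) \<otimes> w)"
      unfolding h(3,6,9) frac_add[OF h(1,2,4,5)]
      using all S_mult[OF h(2,5)] h(7,8) by (subst frac_add) auto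
    moreover have "x \<oplus>\<^bsub>L\<^esub> (y \<oplus>\<^bsub>L\<^esub> z) = frac ((t \<otimes> w) \<otimes> a \<oplus> s \<otimes> (w \<otimes> b \<oplus> t \<otimes> c)) (s \<otimes> (t \<otimes> w))"
      unfolding h(3,6,9) frac_add[OF h(4,5,7,8)]
      using all S_mult[OF h(5,8)] h(1,2) by (subst frac_add) auto
    moreover have "w \<otimes> (t \<otimes> a \<oplus> s \<otimes> b) \<oplus> (s \<otimes> t) \<otimes> c = (t \<otimes> w) \<otimes> a \<oplus> s \<otimes> (w \<otimes> b \<oplus> t \<otimes> c)"
      using all by algebra
    ultimately show "(x \<oplus>\<^bsub>L\<^esub> y) \<oplus>\<^bsub>L\<^esub> z = x \<oplus>\<^bsub>L\<^esub> (y \<oplus>\<^bsub>L\<^esub> z)"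
      using all by (simp add: m_assoc)
  next
    fix x assume "x \<in> carrier L"
    then obtain a s where h: "a \<in> carrier R" "s \<in> S" "x = frac a s" by (rule frac_cases)
    note all = h(1) h(2)[THEN S_carrier]
    show "\<zero>\<^bsub>L\<^esub> \<oplus>\<^bsub>L\<^esub> x = x"
      unfolding zero_L h(3) using all one_in_S h(2) by (subst frac_add) auto
    have "frac (\<ominus> a) s \<oplus>\<^bsub>L\<^esub> x = frac (s \<otimes> (\<ominus> a) \<oplus> s \<otimes> a) (s \<otimes> s)"
      unfolding h(3) using all h(2) by (subst frac_add) auto
    also have "s \<otimes> (\<ominus> a) \<oplus> s \<otimes> a = \<zero>" using all by algebra
    also have "frac \<zero> (s \<otimes> s) = \<zero>\<^bsub>L\<^esub>"
      unfolding zero_L using all S_mult[OF h(2,2)] one_in_S by (intro frac_eqI) auto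
    finally show "\<exists>y\<in>carrier L. y \<oplus>\<^bsub>L\<^esub> x = \<zero>\<^bsub>L\<^esub>"
      using frac_closed[OF a_inv_closed[OF h(1)] h(2)] by blast
  qed
  show "comm_monoid L"
  proof (rule comm_monoidI)
    show "\<one>\<^bsub>L\<^esub> \<in> carrier L" unfolding one_L using frac_closed one_in_S by blast
  next
    fix x y assume "x \<in> carrier L" "y \<in> carrier L"
    then obtain a s b t where h: "a \<in> carrier R" "s \<in> S" "x = frac a s" "b \<in> carrier R" "t \<in> S" "y = frac b t"
      by (metis frac_cases)
    note all = h(1,4) h(2,5)[THEN S_carrier]
    show "x \<otimes>\<^bsub>L\<^esub> y \<in> carrier L"
      unfolding h frac_mult[OF h(1,2,4,5)] using all S_mult[OF h(2,5)] by (intro frac_closed) auto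
    show "x \<otimes>\<^bsub>L\<^esub> y = y \<otimes>\<^bsub>L\<^esub> x"
      unfolding h frac_mult[OF h(1,2,4,5)] frac_mult[OF h(4,5,1,2)]
      using all by (simp add: m_comm)
  next
    fix x y z assume "x \<in> carrier L" "y \<in> carrier L" "z \<in> carrier L"
    then obtain a s b t c w where h: "a \<in> carrier R" "s \<in> S" "x = frac a s"
      "b \<in> carrier R" "t \<in> S" "y = frac b t" "c \<in> carrier R" "w \<in> S" "z = frac c w"
      by (metis frac_cases)
    note all = h(1,4,7) h(2,5,8)[THEN S_carrier]
    show "(x \<otimes>\<^bsub>L\<^esub> y) \<otimes>\<^bsub>L\<^esub> z = x \<otimes>\<^bsub>L\<^esub> (y \<otimes>\<^bsub>L\<^esub> z)"
      using all h S_mult by (simp add: frac_mult m_assoc)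
  next
    fix x assume "x \<in> carrier L"
    then obtain a s where h: "a \<in> carrier R" "s \<in> S" "x = frac a s" by (rule frac_cases)
    show "\<one>\<^bsub>L\<^esub> \<otimes>\<^bsub>L\<^esub> x = x"
      using h one_in_S S_carrier by (simp add: one_L frac_mult)
  qed
  fix x y z assume "x \<in> carrier L" "y \<in> carrier L" "z \<in> carrier L"
  then obtain a s b t c w where h: "a \<in> carrier R" "s \<in> S" "x = frac a s"
    "b \<in> carrier R" "t \<in> S" "y = frac b t" "c \<in> carrier R" "w \<in> S" "z = frac c w"
    by (metis frac_cases)
  note all = h(1,4,7) h(2,5,8)[THEN S_carrier]
  have "(x \<oplus>\<^bsub>L\<^esub> y) \<otimes>\<^bsub>L\<^esub> z = frac ((t \<otimes> a \<oplus> s \<otimes> b) \<otimes> c) ((s \<otimes> t) \<otimes> w)"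
    unfolding h(3,6,9) frac_add[OF h(1,2,4,5)]
    using all S_mult[OF h(2,5)] h(7,8) by (subst frac_mult) auto
  also have "\<dots> = frac ((t \<otimes> w) \<otimes> (a \<otimes> c) \<oplus> (s \<otimes> w) \<otimes> (b \<otimes> c)) ((s \<otimes> w) \<otimes> (t \<otimes> w))"
  proof (rule frac_eqI)
    show "s \<otimes> t \<otimes> w \<in> S" "s \<otimes> w \<otimes> (t \<otimes> w) \<in> S" using h S_mult by auto
    show "(t \<otimes> a \<oplus> s \<otimes> b) \<otimes> c \<in> carrier R"
      "t \<otimes> w \<otimes> (a \<otimes> c) \<oplus> s \<otimes> w \<otimes> (b \<otimes> c) \<in> carrier R" using all by auto
    show "s \<otimes> w \<otimes> (t \<otimes> w) \<otimes> ((t \<otimes> a \<oplus> s \<otimes> b) \<otimes> c)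
        = s \<otimes> t \<otimes> w \<otimes> (t \<otimes> w \<otimes> (a \<otimes> c) \<oplus> s \<otimes> w \<otimes> (b \<otimes> c))"
      using all by algebra
  qed
  also have "\<dots> = x \<otimes>\<^bsub>L\<^esub> z \<oplus>\<^bsub>L\<^esub> y \<otimes>\<^bsub>L\<^esub> z"
    unfolding h(3,6,9) frac_mult[OF h(1,2,7,8)] frac_mult[OF h(4,5,7,8)]
    using all S_mult[OF h(2,8)] S_mult[OF h(5,8)] by (subst frac_add) auto
  finally show "(x \<oplus>\<^bsub>L\<^esub> y) \<otimes>\<^bsub>L\<^esub> z = x \<otimes>\<^bsub>L\<^esub> z \<oplus>\<^bsub>L\<^esub> y \<otimes>\<^bsub>L\<^esub> z" .
qed

lemma S_pow: "s \<in> S \<Longrightarrow> s [^] (n::nat) \<in> S"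
  by (induction n) (auto intro: one_in_S S_mult)

lemma frac_pow:
  assumes "a \<in> carrier R" "s \<in> S"
  shows "frac a s [^]\<^bsub>L\<^esub> (n::nat) = frac (a [^] n) (s [^] n)"
proof (induction n)
  case 0
  show ?case by (simp add: one_L)
next
  case (Suc n)
  then show ?case using assms S_pow by (simp add: frac_mult)
qed

subsection \<open>Extension and contraction of ideals\<close>

definition extension :: "'a set \<Rightarrow> ('a \<times> 'a) set set" where
  "extension I = {frac a s | a s. a \<in> I \<and> s \<in> S}"

definition contraction :: "('a \<times> 'a) set set \<Rightarrow> 'a set" where
  "contraction J = {a \<in> carrier R. frac a \<one> \<in> J}"

lemma frac_in_extension_iff:
  assumes I: "ideal I R" and a: "a \<in> carrier R" and s: "s \<in> S"
  shows "frac a s \<in> extension I \<longleftrightarrow> (\<exists>u\<in>S. u \<otimes> a \<in> I)"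
proof
  interpret I: ideal I R by fact
  assume "frac a s \<in> extension I"
  then obtain b t where bt: "b \<in> I" "t \<in> S" "frac a s = frac b t"
    unfolding extension_def by blast
  then obtain v where v: "v \<in> S" "v \<otimes> (t \<otimes> a) = v \<otimes> (s \<otimes> b)"
    using frac_eq_iff[OF a s I.Icarr[OF bt(1)] bt(2)] by blast
  have "v \<otimes> (s \<otimes> b) \<in> I"
    using bt(1) s v(1) S_carrier I.I_l_closed by blast
  then have "(v \<otimes> t) \<otimes> a \<in> I"
    using v a bt(2) S_carrier by (simp add: m_assoc)
  then show "\<exists>u\<in>S. u \<otimes> a \<in> I" using S_mult v(1) bt(2) by blast
next
  assume "\<exists>u\<in>S. u \<otimes> a \<in> I"
  then obtain u where u: "u \<in> S" "u \<otimes> a \<in> I" by blast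
  then have "frac (u \<otimes> a) (u \<otimes> s) \<in> extension I"
    unfolding extension_def using S_mult s by blast
  then show "frac a s \<in> extension I" using frac_cancel[OF a s u(1)] by simp
qed

lemma ideal_extension:
  assumes I: "ideal I R"
  shows "ideal (extension I) L"
proof (rule cring.ideal_by_closure[OF cring_L])
  interpret I: ideal I R by fact
  show "extension I \<subseteq> carrier L"
    unfolding extension_def carrier_L using I.Icarr by blast
  show "\<zero>\<^bsub>L\<^esub> \<in> extension I"
    unfolding extension_def zero_L using I.zero_closed one_in_S by blast
  show "x \<oplus>\<^bsub>L\<^esub> y \<in> extension I" if xy: "x \<in> extension I" "y \<in> extension I" for x y
  proof -
    obtain a s b t where h: "a \<in> I" "s \<in> S" "x = frac a s" "b \<in> I" "t \<in> S" "y = frac b t"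
      using xy unfolding extension_def by blast
    have "t \<otimes> a \<oplus> s \<otimes> b \<in> I"
      using I.a_closed[OF I.I_l_closed[OF h(1) S_carrier[OF h(5)]] I.I_l_closed[OF h(4) S_carrier[OF h(2)]]] .
    then show ?thesis
      unfolding h(3,6) frac_add[OF I.Icarr[OF h(1)] h(2) I.Icarr[OF h(4)] h(5)] extension_def
      using S_mult[OF h(2,5)] by blast
  qed
  show "r \<otimes>\<^bsub>L\<^esub> x \<in> extension I" if xr: "x \<in> extension I" "r \<in> carrier L" for x r
  proof -
    obtain a s where h: "a \<in> I" "s \<in> S" "x = frac a s"
      using xr(1) unfolding extension_def by blast
    obtain b t where r: "b \<in> carrier R" "t \<in> S" "r = frac b t" using xr(2) by (rule frac_cases)
    show ?thesis
      unfolding h(3) r(3) frac_mult[OF r(1,2) I.Icarr[OF h(1)] h(2)] extension_def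
      using S_mult[OF r(2) h(2)] I.I_l_closed[OF h(1) r(1)] by blast
  qed
qed

text \<open>The fractions \<open>a/s\<close> and \<open>a/1\<close> are multiples of each other.\<close>

lemma frac_in_ideal_iff:
  assumes J: "ideal J L" and a: "a \<in> carrier R" and s: "s \<in> S"
  shows "frac a s \<in> J \<longleftrightarrow> a \<in> contraction J"
proof -
  interpret J: ideal J L by fact
  note one_in_S [simp] s [simp] S_carrier [OF s, simp]
  have "frac a s = frac \<one> s \<otimes>\<^bsub>L\<^esub> frac a \<one>"
    using a by (simp add: frac_mult)
  moreover have "frac a \<one> = frac s \<one> \<otimes>\<^bsub>L\<^esub> frac a s"
    using a frac_cancel[OF a one_in_S s] by (simp add: frac_mult)
  ultimately have "frac a s \<in> J \<longleftrightarrow> frac a \<one> \<in> J"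
    using J.I_l_closed[of "frac a \<one>" "frac \<one> s"] J.I_l_closed[of "frac a s" "frac s \<one>"]
      frac_closed[OF one_closed s] frac_closed[OF S_carrier[OF s] one_in_S] by metis
  then show ?thesis using a by (simp add: contraction_def)
qed

lemma ideal_contraction:
  assumes J: "ideal J L"
  shows "ideal (contraction J) R"
proof (rule ideal_by_closure)
  interpret J: ideal J L by fact
  note one_in_S [simp]
  show "contraction J \<subseteq> carrier R" by (auto simp: contraction_def)
  show "\<zero> \<in> contraction J" using additive_subgroup.zero_closed[OF J.is_additive_subgroup, unfolded zero_L] by (simp add: contraction_def)
  show "x \<oplus> y \<in> contraction J" if "x \<in> contraction J" "y \<in> contraction J" for x y
    using that additive_subgroup.a_closed[OF J.is_additive_subgroup, of "frac x \<one>" "frac y \<one>"]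
    by (simp add: contraction_def frac_add)
  show "r \<otimes> x \<in> contraction J" if "x \<in> contraction J" "r \<in> carrier R" for x r
    using that J.I_l_closed[of "frac x \<one>" "frac r \<one>"] frac_closed[of r \<one>]
    by (simp add: contraction_def frac_mult)
qed

lemma contraction_I: "a \<in> carrier R \<Longrightarrow> frac a \<one> \<in> J \<Longrightarrow> a \<in> contraction J"
  by (simp add: contraction_def)

lemma frac_in_prime_extension_iff:
  assumes P: "primeideal P R" "P \<inter> S = {}" and a: "a \<in> carrier R" "s \<in> S"
  shows "frac a s \<in> extension P \<longleftrightarrow> a \<in> P"
proof -
  interpret P: primeideal P R by fact
  have "u \<otimes> a \<in> P \<longleftrightarrow> a \<in> P" if "u \<in> S" for u
    using P.I_prime[of u a] P.I_l_closed[of a u] S_carrier[OF that] that P(2) a(1) by blast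
  then show ?thesis
    using frac_in_extension_iff[OF P.is_ideal a] one_in_S by blast
qed

lemma primeideal_extension:
  assumes P: "primeideal P R" "P \<inter> S = {}"
  shows "primeideal (extension P) L"
proof (rule primeidealI)
  interpret P: primeideal P R by fact
  show "ideal (extension P) L" using ideal_extension[OF P.is_ideal] .
  show "cring L" by (rule cring_L)
  have "\<one> \<notin> P" using P(2) one_in_S by blast
  then have "frac \<one> \<one> \<notin> extension P"
    using frac_in_prime_extension_iff[OF P one_closed one_in_S] by blast
  then show "carrier L \<noteq> extension P" using frac_closed[OF one_closed one_in_S] by blast
  fix x y assume "x \<in> carrier L" "y \<in> carrier L" and xy: "x \<otimes>\<^bsub>L\<^esub> y \<in> extension P"
  then obtain a s b t where h: "a \<in> carrier R" "s \<in> S" "x = frac a s" "b \<in> carrier R" "t \<in> S" "y = frac b t"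
    by (metis frac_cases)
  have "a \<otimes> b \<in> P"
    using xy frac_in_prime_extension_iff[OF P m_closed[OF h(1,4)] S_mult[OF h(2,5)]]
    unfolding h(3,6) frac_mult[OF h(1,2,4,5)] by blast
  then show "x \<in> extension P \<or> y \<in> extension P"
    using P.I_prime[OF h(1,4)] frac_in_prime_extension_iff[OF P] h by blast
qed

lemma primeideal_contraction:
  assumes "primeideal Q L"
  shows "primeideal (contraction Q) R" and "contraction Q \<inter> S = {}"
proof -
  interpret Q: primeideal Q L by fact
  have one: "frac \<one> \<one> \<notin> Q"
    using Q.one_imp_carrier Q.I_notcarr by (auto simp: one_L)
  have "u \<notin> contraction Q" if u: "u \<in> S" for u
  proof
    assume "u \<in> contraction Q"
    then have "frac (u \<otimes> \<one>) (u \<otimes> \<one>) \<in> Q"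
      using frac_in_ideal_iff[OF Q.is_ideal S_carrier[OF u] u] S_carrier[OF u] by simp
    then show False using one frac_cancel[OF one_closed one_in_S u] by simp
  qed
  then show disj: "contraction Q \<inter> S = {}" by blast
  show "primeideal (contraction Q) R"
  proof (rule primeidealI[OF ideal_contraction[OF Q.is_ideal] is_cring])
    show "carrier R \<noteq> contraction Q" using disj one_in_S by blast
    fix a b assume ab: "a \<in> carrier R" "b \<in> carrier R" "a \<otimes> b \<in> contraction Q"
    then have "frac a \<one> \<otimes>\<^bsub>L\<^esub> frac b \<one> \<in> Q"
      using one_in_S by (simp add: contraction_def frac_mult)
    then show "a \<in> contraction Q \<or> b \<in> contraction Q"
      using Q.I_prime[of "frac a \<one>" "frac b \<one>"] frac_closed[OF _ one_in_S] ab(1,2) contraction_I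
      by blast
  qed
qed

lemma extension_contraction:
  assumes J: "ideal J L"
  shows "extension (contraction J) = J"
proof
  show "extension (contraction J) \<subseteq> J"
  proof
    fix x assume "x \<in> extension (contraction J)"
    then obtain a s where "a \<in> contraction J" "s \<in> S" "x = frac a s"
      unfolding extension_def by blast
    then show "x \<in> J"
      using frac_in_ideal_iff[OF J ideal.Icarr[OF ideal_contraction[OF J]]] by blast
  qed
  show "J \<subseteq> extension (contraction J)"
  proof
    fix x assume x: "x \<in> J"
    then obtain a s where as: "a \<in> carrier R" "s \<in> S" "x = frac a s"
      using ideal.Icarr[OF J] frac_cases by metis
    then have "a \<in> contraction J" using frac_in_ideal_iff[OF J as(1,2)] x by blast
    then show "x \<in> extension (contraction J)" unfolding extension_def using as by blast
  qed
qed

lemma contraction_prime_extension: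
  assumes P: "primeideal P R" "P \<inter> S = {}"
  shows "contraction (extension P) = P"
proof -
  interpret P: primeideal P R by fact
  show ?thesis
    using frac_in_prime_extension_iff[OF P _ one_in_S] P.Icarr
    unfolding contraction_def by blast
qed

lemma minimal_prime_extension:
  assumes P: "minimal_prime P R" "P \<inter> S = {}"
  shows "minimal_prime (extension P) L"
  unfolding minimal_prime_def
proof (intro conjI allI impI)
  have prime: "primeideal P R" and min: "\<And>Q. primeideal Q R \<Longrightarrow> Q \<subseteq> P \<Longrightarrow> Q = P"
    using P(1) by (simp_all add: minimal_prime_def)
  show "primeideal (extension P) L" using primeideal_extension[OF prime P(2)] .
  fix Q assume Q: "primeideal Q L \<and> Q \<subseteq> extension P"
  then have "contraction Q \<subseteq> contraction (extension P)" by (auto simp: contraction_def)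
  then have "contraction Q = P"
    using min primeideal_contraction(1) Q contraction_prime_extension[OF prime P(2)] by auto
  then show "Q = extension P"
    using extension_contraction[OF primeideal.axioms(1)] Q by blast
qed

lemma minimal_prime_contraction:
  assumes "minimal_prime Q L"
  shows "minimal_prime (contraction Q) R"
  unfolding minimal_prime_def
proof (intro conjI allI impI)
  have prime: "primeideal Q L" and min: "\<And>P. primeideal P L \<Longrightarrow> P \<subseteq> Q \<Longrightarrow> P = Q"
    using assms by (simp_all add: minimal_prime_def)
  show "primeideal (contraction Q) R" using primeideal_contraction(1)[OF prime] .
  fix P assume P: "primeideal P R \<and> P \<subseteq> contraction Q"
  then have disj: "P \<inter> S = {}" using primeideal_contraction(2)[OF prime] by blast
  have "extension P \<subseteq> extension (contraction Q)" using P unfolding extension_def by blast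
  then have "extension P = Q"
    using min primeideal_extension P disj extension_contraction[OF primeideal.axioms(1)[OF prime]]
    by auto
  then show "P = contraction Q" using contraction_prime_extension P disj by blast
qed

text \<open>A minimal prime of \<open>R\<close> disjoint from \<open>S\<close> extends to a minimal prime of the localization.  Nothing
  can be said about the minimal primes that meet \<open>S\<close>, which disappear in the localization.\<close>

lemma numerator_notin_minimal_prime:
  assumes "frac a s \<in> ring_circ L" "s \<in> S" "minimal_prime P R" "P \<inter> S = {}"
  shows "a \<notin> P"
proof
  assume "a \<in> P"
  then have "frac a s \<in> extension P" unfolding extension_def using assms(2) by blast
  then show False
    using assms(1) minimal_prime_extension[OF assms(3,4)] by (auto simp: ring_circ_def)
qed

lemma frac_in_ring_circ:
  assumes "c \<in> ring_circ R"
  shows "frac c \<one> \<in> ring_circ L"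
proof -
  have c: "c \<in> carrier R" "\<And>P. minimal_prime P R \<Longrightarrow> c \<notin> P"
    using assms by (auto simp: ring_circ_def)
  have "frac c \<one> \<notin> Q" if "minimal_prime Q L" for Q
    using c minimal_prime_contraction[OF that] contraction_I by blast
  then show ?thesis using frac_closed[OF c(1) one_in_S] by (auto simp: ring_circ_def)
qed

text \<open>Frobenius powers commute with localization.  The ideal \<open>I\<close> may exceed the contraction of \<open>J\<close>, so
  that membership can be tested in an ideal chosen for its better cancellation properties.\<close>

lemma frobenius_power_localization:
  assumes J: "ideal J L" and I: "ideal I R" and sub: "contraction J \<subseteq> I"
    and a: "a \<in> carrier R" "s \<in> S" and mem: "frac a s \<in> frobenius_power L J q"
  shows "\<exists>u\<in>S. u \<otimes> a \<in> frobenius_power R I q"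
proof -
  note Iq = ideal_frobenius_power[OF I, where q = q]
  have "frobenius_power L J q \<subseteq> extension (frobenius_power R I q)"
  proof (rule cring.frobenius_power_subset[OF cring_L ideal_extension[OF Iq(1)]])
    fix x assume x: "x \<in> J"
    then obtain b t where bt: "b \<in> carrier R" "t \<in> S" "x = frac b t"
      using ideal.Icarr[OF J] frac_cases by metis
    then have "b \<in> I" using frac_in_ideal_iff[OF J bt(1,2)] x sub by blast
    then show "x [^]\<^bsub>L\<^esub> q \<in> extension (frobenius_power R I q)"
      unfolding bt(3) frac_pow[OF bt(1,2)] extension_def using Iq(2) S_pow[OF bt(2)] by blast
  qed
  then show ?thesis using mem frac_in_extension_iff[OF Iq(1) a] by blast
qed

lemma frac_in_frobenius_power_extension:
  assumes I: "ideal I R" and a: "a \<in> frobenius_power R I q"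
  shows "frac a \<one> \<in> frobenius_power L (extension I) q"
proof -
  note Eq = cring.ideal_frobenius_power[OF cring_L ideal_extension[OF I], where q = q]
  have "frobenius_power R I q \<subseteq> contraction (frobenius_power L (extension I) q)"
  proof (rule frobenius_power_subset[OF ideal_contraction[OF Eq(1)]])
    fix x assume x: "x \<in> I"
    then have xc: "x \<in> carrier R" using ideal.Icarr[OF I] by blast
    have "frac x \<one> \<in> extension I" unfolding extension_def using x one_in_S by blast
    then have "frac (x [^] q) \<one> \<in> frobenius_power L (extension I) q"
      using Eq(2)[of "frac x \<one>"] frac_pow[OF xc one_in_S, of q] by simp
    then show "x [^] q \<in> contraction (frobenius_power L (extension I) q)"
      using contraction_I xc by blast
  qed
  then show ?thesis using a by (auto simp: contraction_def)
qed

text \<open>A witness \<open>c\<close> for \<open>z\<close> localizes to the witness \<open>c/1\<close>, because minimal primes of the localization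
  contract to minimal primes.\<close>

lemma frac_in_tight_closure_extension:
  assumes I: "ideal I R" and z: "z \<in> tight_closure p R I"
  shows "frac z \<one> \<in> tight_closure p L (extension I)"
proof -
  obtain c e\<^sub>0 where zc: "z \<in> carrier R" and c: "c \<in> ring_circ R"
    and mem: "\<And>e. e \<ge> e\<^sub>0 \<Longrightarrow> c \<otimes> z [^] (p ^ e) \<in> frobenius_power R I (p ^ e)"
    using z unfolding tight_closure_def by blast
  have cc: "c \<in> carrier R" using c by (simp add: ring_circ_def)
  have "frac c \<one> \<otimes>\<^bsub>L\<^esub> frac z \<one> [^]\<^bsub>L\<^esub> (p ^ e) = frac (c \<otimes> z [^] (p ^ e)) \<one>" for e
    using cc zc one_in_S by (simp add: frac_pow frac_mult)
  then have "\<forall>e\<ge>e\<^sub>0. frac c \<one> \<otimes>\<^bsub>L\<^esub> frac z \<one> [^]\<^bsub>L\<^esub> (p ^ e) \<in> frobenius_power L (extension I) (p ^ e)"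
    using frac_in_frobenius_power_extension[OF I mem] by simp
  then show ?thesis
    unfolding tight_closure_def using frac_in_ring_circ[OF c] frac_closed[OF zc one_in_S] by blast
qed

end

section \<open>Passing between a ring and its localizations\<close>

lemma (in cring) mult_subset_powers:
  assumes "f \<in> carrier R"
  shows "mult_subset R (range (\<lambda>n::nat. f [^] n))"
proof
  show "range (\<lambda>n::nat. f [^] n) \<subseteq> carrier R" using assms by auto
  show "\<one> \<in> range (\<lambda>n::nat. f [^] n)" by (rule range_eqI[of _ _ 0]) simp
  fix s t assume "s \<in> range (\<lambda>n::nat. f [^] n)" "t \<in> range (\<lambda>n::nat. f [^] n)"
  then obtain n m where "s = f [^] (n::nat)" "t = f [^] (m::nat)" by blast
  then show "s \<otimes> t \<in> range (\<lambda>n::nat. f [^] n)"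
    using assms by (simp add: nat_pow_mult)
qed

text \<open>The localization at \<open>\<one>\<close> is used.  All its denominators are \<open>\<one>\<close>, so a fraction \<open>z/1\<close> in the
  extension of \<open>I\<close> comes from an element \<open>z\<close> of \<open>I\<close>.\<close>

lemma (in cring) semi_imp_weakly_F_regular:
  assumes "semi_F_regular p R"
  shows "weakly_F_regular p R"
  unfolding weakly_F_regular_def
proof (intro allI impI)
  fix I assume I: "ideal I R"
  interpret mult_subset R "range (\<lambda>n::nat. \<one> [^] n)"
    by (rule mult_subset_powers[OF one_closed])
  have "weakly_F_regular p L"
    using assms one_closed unfolding semi_F_regular_def localization_at_elem_def by blast
  then have closed: "tight_closure p L (extension I) = extension I"
    using ideal_extension[OF I] unfolding weakly_F_regular_def by blast
  have "z \<in> I" if z: "z \<in> tight_closure p R I" for z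
  proof -
    have zc: "z \<in> carrier R" using z by (simp add: tight_closure_def)
    have "frac z \<one> \<in> extension I"
      using frac_in_tight_closure_extension[OF I z] closed by simp
    then obtain u where "u \<in> range (\<lambda>n::nat. \<one> [^] n)" "u \<otimes> z \<in> I"
      using frac_in_extension_iff[OF I zc one_in_S] by blast
    then show ?thesis using zc by auto
  qed
  then show "tight_closure p R I = I" using ideal_subset_tight_closure[OF I] by blast
qed

text \<open>The elements killed by a power of \<open>f\<close> form the kernel \<open>N\<close> of the map to \<open>R\<^sub>f\<close>, so \<open>a\<close> is changed
  without changing \<open>a/1\<close>.  Coset avoidance applies: a minimal prime containing \<open>a\<close> contains \<open>f\<close> by
  hypothesis, and then it does not contain \<open>N\<close> by \<open>minimal_prime_torsion\<close>.\<close>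

lemma (in noetherian_ring) ring_circ_representative:
  assumes "cring R" and f: "f \<in> carrier R" and a: "a \<in> carrier R"
    and notin: "\<And>P. minimal_prime P R \<Longrightarrow> f \<notin> P \<Longrightarrow> a \<notin> P"
  shows "\<exists>d\<in>carrier R. (\<exists>n::nat. f [^] n \<otimes> d = \<zero>) \<and> a \<oplus> d \<in> ring_circ R"
proof -
  interpret cring R by fact
  define N where "N = {d \<in> carrier R. \<exists>n::nat. f [^] n \<otimes> d = \<zero>}"
  have N: "ideal N R"
  proof (rule ideal_by_closure)
    show "N \<subseteq> carrier R" by (auto simp: N_def)
    show "\<zero> \<in> N" using f by (auto simp: N_def)
    show "x \<oplus> y \<in> N" if xy: "x \<in> N" "y \<in> N" for x y
    proof -
      obtain n m where h: "x \<in> carrier R" "y \<in> carrier R" "f [^] (n::nat) \<otimes> x = \<zero>" "f [^] (m::nat) \<otimes> y = \<zero>"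
        using xy unfolding N_def by blast
      have "f [^] (n + m) \<otimes> (x \<oplus> y) = f [^] m \<otimes> (f [^] n \<otimes> x) \<oplus> f [^] n \<otimes> (f [^] m \<otimes> y)"
        using h(1,2) f by (simp add: nat_pow_mult[symmetric] r_distr m_ac)
      also have "\<dots> = \<zero>" unfolding h(3,4) using f by simp
      finally show ?thesis using h(1,2) unfolding N_def by blast
    qed
    show "r \<otimes> x \<in> N" if x: "x \<in> N" "r \<in> carrier R" for x r
    proof -
      obtain n where h: "x \<in> carrier R" "f [^] (n::nat) \<otimes> x = \<zero>" using x unfolding N_def by blast
      have "f [^] n \<otimes> (r \<otimes> x) = r \<otimes> (f [^] n \<otimes> x)" using h(1) x(2) f by (simp add: m_ac)
      also have "\<dots> = \<zero>" unfolding h(2) using x(2) by simp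
      finally show ?thesis using h(1) x(2) unfolding N_def by blast
    qed
  qed
  have "\<exists>d\<in>N. \<forall>P\<in>{P. minimal_prime P R}. a \<oplus> d \<notin> P"
  proof (rule coset_prime_avoidance[OF N a finite_minimal_primes[OF is_cring]])
    fix P assume P: "P \<in> {P. minimal_prime P R}"
    then show "primeideal P R" by (simp add: minimal_prime_def)
    show "P = Q" if "Q \<in> {P. minimal_prime P R}" "P \<subseteq> Q" for Q
      using P that by (simp add: minimal_prime_def)
    assume "a \<in> P"
    then have "f \<in> P" using notin P by blast
    then obtain s n where s: "s \<in> carrier R" "s \<notin> P" "s \<otimes> f [^] (n::nat) = \<zero>"
      using minimal_prime_torsion[OF is_cring] P by blast
    then have "s \<in> N" using m_comm[OF s(1) nat_pow_closed[OF f]] unfolding N_def by force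
    then show "\<not> N \<subseteq> P" using s(2) by blast
  qed
  then obtain d where d: "d \<in> N" "\<forall>P. minimal_prime P R \<longrightarrow> a \<oplus> d \<notin> P" by blast
  then have "d \<in> carrier R" "\<exists>n::nat. f [^] n \<otimes> d = \<zero>" unfolding N_def by blast+
  moreover have "a \<oplus> d \<in> ring_circ R" using d(2) a \<open>d \<in> carrier R\<close> by (simp add: ring_circ_def)
  ultimately show ?thesis by blast
qed

lemma (in noetherian_ring) weakly_imp_semi_F_regular:
  assumes jac: "jacobson_ring R" and weak: "weakly_F_regular p R"
  shows "semi_F_regular p R"
  unfolding semi_F_regular_def weakly_F_regular_def
proof (intro ballI allI impI)
  interpret cring R using jac by (simp add: jacobson_ring_def)
  fix f J assume f: "f \<in> carrier R" and "ideal J (localization_at_elem R f)"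
  define S where "S = range (\<lambda>n::nat. f [^] n)"
  interpret mult_subset R S unfolding S_def by (rule mult_subset_powers[OF f])
  have L: "localization_at_elem R f = L" by (simp add: localization_at_elem_def S_def)
  have J: "ideal J L" using \<open>ideal J (localization_at_elem R f)\<close> by (simp add: L)
  have "z \<in> J" if z: "z \<in> tight_closure p L J" for z
  proof (rule ccontr)
    assume "z \<notin> J"
    obtain c e\<^sub>0 where zc: "z \<in> carrier L" and c: "c \<in> ring_circ L"
      and mem: "\<And>e. e \<ge> e\<^sub>0 \<Longrightarrow> c \<otimes>\<^bsub>L\<^esub> z [^]\<^bsub>L\<^esub> (p ^ e) \<in> frobenius_power L J (p ^ e)"
      using z unfolding tight_closure_def by blast
    obtain x s where x: "x \<in> carrier R" "s \<in> S" "z = frac x s" using zc by (rule frac_cases)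
    have "c \<in> carrier L" using c by (simp add: ring_circ_def)
    then obtain a t where a: "a \<in> carrier R" "t \<in> S" "c = frac a t" by (rule frac_cases)
    have notin: "f [^] n \<otimes> x \<notin> contraction J" for n :: nat
    proof
      have fn: "f [^] n \<in> S" by (simp add: S_def)
      assume "f [^] n \<otimes> x \<in> contraction J"
      then have "frac (f [^] n \<otimes> x) (f [^] n \<otimes> s) \<in> J"
        using frac_in_ideal_iff[OF J m_closed[OF S_carrier[OF fn] x(1)] S_mult[OF fn x(2)]] by blast
      then show False using \<open>z \<notin> J\<close> frac_cancel[OF x(1,2) fn] x(3) by simp
    qed
    obtain K r k where K: "ideal K R" "contraction J \<subseteq> K" "x \<notin> K"
      and r: "r \<in> carrier R" "(\<one> \<ominus> r \<otimes> f) [^] (k::nat) \<in> K"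
      using jacobson_separating_ideal[OF jac ideal_contraction[OF J] f x(1)] notin by blast
    \<comment> \<open>All \<open>u \<in> S\<close> are powers of \<open>f\<close>, and \<open>f\<close> is invertible modulo every Frobenius power of \<open>K\<close>.\<close>
    have cancel: "y \<in> frobenius_power R K q"
      if "y \<in> carrier R" "u \<in> S" "u \<otimes> y \<in> frobenius_power R K q" for y u q
      using cancel_power_mod_frobenius_power[OF K(1) f r(1) that(1) r(2)] that(2,3)
      unfolding S_def by blast
    have "a \<notin> P" if P: "minimal_prime P R" "f \<notin> P" for P
    proof -
      interpret P: primeideal P R using P(1) by (simp add: minimal_prime_def)
      have "f [^] n \<notin> P" for n :: nat
      proof (induction n)
        case 0
        show ?case using P.one_imp_carrier P.I_notcarr by auto
      next
        case (Suc n)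
        show ?case using P.I_prime[of "f [^] n" f] f P(2) Suc by auto
      qed
      then have "P \<inter> S = {}" unfolding S_def by blast
      then show ?thesis using numerator_notin_minimal_prime c a(2,3) P(1) by blast
    qed
    then obtain d n where d: "d \<in> carrier R" "f [^] (n::nat) \<otimes> d = \<zero>" "a \<oplus> d \<in> ring_circ R"
      using ring_circ_representative[OF is_cring f a(1)] by blast
    have "(a \<oplus> d) \<otimes> x [^] (p ^ e) \<in> frobenius_power R K (p ^ e)" if e: "e \<ge> e\<^sub>0" for e
    proof -
      define y where "y = x [^] (p ^ e)"
      have y: "y \<in> carrier R" using x(1) by (simp add: y_def)
      interpret Kq: ideal "frobenius_power R K (p ^ e)" R by (rule ideal_frobenius_power(1)[OF K(1)])
      have "frac (a \<otimes> y) (t \<otimes> s [^] (p ^ e)) \<in> frobenius_power L J (p ^ e)"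
        using mem[OF e] unfolding a(3) x(3) frac_pow[OF x(1,2)] y_def
        by (simp add: frac_mult a x S_pow)
      then obtain u where "u \<in> S" "u \<otimes> (a \<otimes> y) \<in> frobenius_power R K (p ^ e)"
        using frobenius_power_localization[OF J K(1,2) m_closed[OF a(1) y] S_mult[OF a(2) S_pow[OF x(2)]]]
        by blast
      then have ay: "a \<otimes> y \<in> frobenius_power R K (p ^ e)"
        using cancel m_closed[OF a(1) y] by blast
      have "f [^] n \<otimes> (d \<otimes> y) = (f [^] n \<otimes> d) \<otimes> y" using f d(1) y by (simp add: m_assoc)
      then have "f [^] n \<otimes> (d \<otimes> y) \<in> frobenius_power R K (p ^ e)"
        using d(2) y Kq.zero_closed by simp
      then have "d \<otimes> y \<in> frobenius_power R K (p ^ e)"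
        using cancel[OF m_closed[OF d(1) y], of "f [^] n"] by (simp add: S_def)
      then show ?thesis
        using Kq.a_closed[OF ay] l_distr[OF a(1) d(1) y] by (simp add: y_def)
    qed
    then have "x \<in> tight_closure p R K" unfolding tight_closure_def using x(1) d(3) by blast
    then show False using weak K(1,3) unfolding weakly_F_regular_def by blast
  qed
  then show "tight_closure p (localization_at_elem R f) J = J"
    unfolding L using cring.ideal_subset_tight_closure[OF cring_L J] by blast
qed

theorem proposition4p20:
  fixes R :: "('a, 'b) ring_scheme" and p :: nat
  assumes "prime p"
    and "Fp_algebra p R"
    and "noetherian_ring R"
    and "jacobson_ring R"
  shows "semi_F_regular p R \<longleftrightarrow> weakly_F_regular p R"
proof -
  interpret cring R using assms(4) by (simp add: jacobson_ring_def)
  show ?thesis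
    using semi_imp_weakly_F_regular noetherian_ring.weakly_imp_semi_F_regular[OF assms(3,4)] by blast
qed

end
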